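(* Let $n\ge 3$, let $V_n$ be the $(n-1)$-dimensional standard representation of $S_n$ over $\mathbb{C}$, and let $1\le k\le n-2$. Then for every $\alpha\in\mathbb{C}$ the action of $S_n$ on the irreducible $S_n$-representation $\Lambda^kV_n$ extends to an action of $\mathcal{V}_n$ (with $s_i$ acting as the simple transposition $(i,i+1)$) such that every $e_i$, $1\le i\le n-1$, acts by a nonzero operator, the $y_j$, $1\le j\le n$, act by simultaneously diagonalizable operators, and $y_1$ acts by the scalar $\alpha\,\mathrm{Id}$; this makes $\Lambda^kV_n$ into an irreducible calibrated $\mathcal{V}_n$-representation, denoted $\mathrm{C}_\alpha(\Lambda^kV_n)$. When $\alpha=0$, $\mathrm{C}_0(\Lambda^kV_n)$ is an irreducible calibrated $A_n$-representation.
   Context: For $n\ge 1$, the degenerate affine periplectic Brauer algebra $\mathcal{V}_n$ is the unital associative $\mathbb{C}$-algebra with generators $s_i,e_i$ ($1\le i\le n-1$) and $y_j$ ($1\le j\le n$) and relations (for all indices for which the expressions make sense): $s_i^2=1$; $s_is_j=s_js_i$, $s_ie_j=e_js_i$, $e_ie_j=e_je_i$ if $|i-j|>1$; $s_is_{i+1}s_i=s_{i+1}s_is_{i+1}$; $y_iy_j=y_jy_i$; $e_iy_j=y_je_i$ and $s_iy_j=y_js_i$ if $j\ne i,i+1$; $e_{i+1}e_ie_{i+1}=-e_{i+1}$; $e_ie_{i+1}e_i=-e_i$; $e_is_i=e_i$; $s_ie_i=-e_i$; $s_ie_{i+1}e_i=s_{i+1}e_i$; $s_{i+1}e_ie_{i+1}=-s_ie_{i+1}$;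 $e_{i+1}e_is_{i+1}=e_{i+1}s_i$; $e_ie_{i+1}s_i=-e_is_{i+1}$; $e_i^2=0$; $s_iy_i-y_{i+1}s_i=-e_i-1$; $y_is_i-s_iy_{i+1}=e_i-1$; $e_i(y_i-y_{i+1})=-e_i$; $(y_i-y_{i+1})e_i=e_i$. The periplectic Brauer algebra $A_n$ is the subalgebra of $\mathcal{V}_n$ generated by $s_i,e_i$, $1\le i\le n-1$ (equivalently, it is presented by these generators and the relations above not involving any $y_j$). Its Jucys--Murphy elements are $Y_1:=0$, $Y_{j+1}:=s_jY_js_j+s_j+e_j$. There is a surjection $\mathcal{V}_n\to A_n$ with $e_i\mapsto e_i$, $s_i\mapsto s_i$, $y_j\mapsto Y_j$, whose kernel is the two-sided ideal generated by $y_1$. A representation of $\mathcal{V}_n$ (resp. $A_n$) is called calibrated if it has a basis with respect to which all $y_j$ (resp. all $Y_j$), $1\le j\le n$, act by diagonal matrices. A calibrated $A_n$-representation is the same thing as a calibrated $\mathcal{V}_n$-representation on which $y_1$ acts by $0$. The standard representation $V_n$ is the irreducible $S_n$-representation labeled by the partition $(n-1,1)$. *)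

theory Defs
  imports
    Complex_Main
    "HOL-Algebra.Module"
    "HOL-Algebra.QuotRing"
    "HOL-Combinatorics.Permutations"
    "HOL-Library.Poly_Mapping"
    "HOL-Library.Function_Algebras"
begin

section \<open>Algebras given by generators and relations\<close>

text \<open>
  Words under concatenation form the free monoid; as an additive monoid they can serve as
  exponents of \<^type>\<open>poly_mapping\<close>, whose convolution product then is the product of the free
  (noncommutative) algebra.
\<close>

datatype 'g fword = FWord (letters: "'g list")

instantiation fword :: (type) monoid_add
begin
definition "0 = FWord []"
definition "u + v = FWord (letters u @ letters v)"
instance
  by standard (simp_all add: zero_fword_def plus_fword_def)
end

text \<open>
  A complex algebra is given by a record of type \<^typ>\<open>(complex, 'a) module\<close>: a ring together with
  a scalar multiplication by complex numbers.
\<close>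

definition free_algebra :: "'g set \<Rightarrow> (complex, 'g fword \<Rightarrow>\<^sub>0 complex) module" where
  "free_algebra G =
     \<lparr>carrier = {p. \<forall>w\<in>Poly_Mapping.keys p. set (letters w) \<subseteq> G},
      monoid.mult = (*), one = 1, zero = 0, add = (+),
      smult = (\<lambda>c p. Poly_Mapping.single 0 c * p)\<rparr>"

definition quotient_algebra ::
    "(complex, 'a) module \<Rightarrow> 'a set \<Rightarrow> (complex, 'a set) module" where
  "quotient_algebra A I =
     ring.extend (A Quot I) (module.fields (\<lambda>c X. \<Union>x\<in>X. I +>\<^bsub>A\<^esub> (c \<odot>\<^bsub>A\<^esub> x)))"

definition rel_ideal ::
    "'g set \<Rightarrow> (('g fword \<Rightarrow>\<^sub>0 complex) \<Rightarrow> ('g fword \<Rightarrow>\<^sub>0 complex) \<Rightarrow> bool)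
      \<Rightarrow> ('g fword \<Rightarrow>\<^sub>0 complex) set" where
  "rel_ideal G R = Idl\<^bsub>free_algebra G\<^esub> {p - q |p q. R p q}"

text \<open>The algebra with generating set \<open>G\<close> and relations \<open>p = q\<close> for all \<open>p q\<close> with \<open>R p q\<close>.\<close>

definition presented_algebra ::
    "'g set \<Rightarrow> (('g fword \<Rightarrow>\<^sub>0 complex) \<Rightarrow> ('g fword \<Rightarrow>\<^sub>0 complex) \<Rightarrow> bool)
      \<Rightarrow> (complex, ('g fword \<Rightarrow>\<^sub>0 complex) set) module" where
  "presented_algebra G R = quotient_algebra (free_algebra G) (rel_ideal G R)"

definition free_gen :: "'g \<Rightarrow> 'g fword \<Rightarrow>\<^sub>0 complex" where
  "free_gen g = Poly_Mapping.single (FWord [g]) 1"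

inductive_set gen_subalgebra :: "(complex, 'a) module \<Rightarrow> 'a set \<Rightarrow> 'a set"
  for A :: "(complex, 'a) module" and H :: "'a set" where
  one: "\<one>\<^bsub>A\<^esub> \<in> gen_subalgebra A H"
| incl: "h \<in> H \<Longrightarrow> h \<in> gen_subalgebra A H"
| add: "a \<in> gen_subalgebra A H \<Longrightarrow> b \<in> gen_subalgebra A H \<Longrightarrow> a \<oplus>\<^bsub>A\<^esub> b \<in> gen_subalgebra A H"
| mult: "a \<in> gen_subalgebra A H \<Longrightarrow> b \<in> gen_subalgebra A H \<Longrightarrow> a \<otimes>\<^bsub>A\<^esub> b \<in> gen_subalgebra A H"
| smult: "a \<in> gen_subalgebra A H \<Longrightarrow> c \<odot>\<^bsub>A\<^esub> a \<in> gen_subalgebra A H"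

lemma ring_free_algebra: "ring (free_algebra G)"
proof -
  define C where "C = {p :: 'a fword \<Rightarrow>\<^sub>0 complex. \<forall>w\<in>Poly_Mapping.keys p. set (letters w) \<subseteq> G}"
  have F: "carrier (free_algebra G) = C" "monoid.mult (free_algebra G) = (*)"
    "\<one>\<^bsub>free_algebra G\<^esub> = 1" "\<zero>\<^bsub>free_algebra G\<^esub> = 0" "add (free_algebra G) = (+)"
    by (simp_all add: free_algebra_def C_def)
  have zero: "0 \<in> C" and one: "1 \<in> C" and uminus: "\<And>p. p \<in> C \<Longrightarrow> - p \<in> C"
    by (auto simp: C_def zero_fword_def simp flip: single_one)
  have add: "p + q \<in> C" if "p \<in> C" "q \<in> C" for p q
    using that Poly_Mapping.keys_add[of p q] unfolding C_def by blast
  have mult: "p * q \<in> C" if "p \<in> C" "q \<in> C" for p q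
  proof -
    have "set (letters w) \<subseteq> G" if w: "w \<in> Poly_Mapping.keys (p * q)" for w
    proof -
      obtain u v where "w = u + v" "u \<in> Poly_Mapping.keys p" "v \<in> Poly_Mapping.keys q"
        using w keys_mult[of p q] by blast
      then show ?thesis
        using \<open>p \<in> C\<close> \<open>q \<in> C\<close> by (simp add: C_def plus_fword_def)
    qed
    then show ?thesis by (simp add: C_def)
  qed
  have "abelian_group (free_algebra G)"
    by (rule abelian_groupI)
      (auto simp: F add zero add.assoc add.commute intro: bexI[of _ "- x" for x] uminus)
  moreover have "Group.monoid (free_algebra G)"
    by (rule monoidI) (simp_all add: F mult one mult.assoc)
  ultimately show ?thesis
    by (rule ringI) (simp_all add: F distrib_left distrib_right)
qed

lemma free_algebra_closed:
  "0 \<in> carrier (free_algebra G)" "1 \<in> carrier (free_algebra G)"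
  "g \<in> G \<Longrightarrow> free_gen g \<in> carrier (free_algebra G)"
  "p \<in> carrier (free_algebra G) \<Longrightarrow> - p \<in> carrier (free_algebra G)"
  "p \<in> carrier (free_algebra G) \<Longrightarrow> q \<in> carrier (free_algebra G) \<Longrightarrow> p + q \<in> carrier (free_algebra G)"
  "p \<in> carrier (free_algebra G) \<Longrightarrow> q \<in> carrier (free_algebra G) \<Longrightarrow> p - q \<in> carrier (free_algebra G)"
  "p \<in> carrier (free_algebra G) \<Longrightarrow> q \<in> carrier (free_algebra G) \<Longrightarrow> p * q \<in> carrier (free_algebra G)"
proof -
  interpret ring "free_algebra G" by (rule ring_free_algebra)
  have F: "monoid.mult (free_algebra G) = (*)" "\<one>\<^bsub>free_algebra G\<^esub> = 1"
    "\<zero>\<^bsub>free_algebra G\<^esub> = 0" "add (free_algebra G) = (+)"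
    by (simp_all add: free_algebra_def)
  have neg: "- p \<in> carrier (free_algebra G)" if "p \<in> carrier (free_algebra G)" for p
    using that by (simp add: free_algebra_def)
  show "0 \<in> carrier (free_algebra G)" "1 \<in> carrier (free_algebra G)"
    using zero_closed one_closed by (simp_all only: F)
  show "g \<in> G \<Longrightarrow> free_gen g \<in> carrier (free_algebra G)"
    by (simp add: free_gen_def free_algebra_def)
  show "p \<in> carrier (free_algebra G) \<Longrightarrow> - p \<in> carrier (free_algebra G)" by (rule neg)
  assume p: "p \<in> carrier (free_algebra G)" and q: "q \<in> carrier (free_algebra G)"
  show "p + q \<in> carrier (free_algebra G)" "p * q \<in> carrier (free_algebra G)"
    using a_closed[OF p q] m_closed[OF p q] by (simp_all only: F)
  show "p - q \<in> carrier (free_algebra G)"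
    using a_closed[OF p neg[OF q]] by (simp add: F)
qed

lemma smult_quotient:
  assumes "ideal I (free_algebra G)" "p \<in> carrier (free_algebra G)"
  shows "c \<odot>\<^bsub>quotient_algebra (free_algebra G) I\<^esub> (I +>\<^bsub>free_algebra G\<^esub> p) = I +>\<^bsub>free_algebra G\<^esub> (Poly_Mapping.single 0 c * p)"
proof -
  interpret ideal I "free_algebra G" by fact
  have cs: "Poly_Mapping.single 0 c \<in> carrier (free_algebra G)" 
    by (auto simp: free_algebra_def zero_fword_def)
  have I: "I \<subseteq> carrier (free_algebra G)" by (rule a_subset)
  { fix x assume "x \<in> I +>\<^bsub>free_algebra G\<^esub> p"
    then obtain h where h: "h \<in> I" "x = h + p" by (auto simp: a_r_coset_def' free_algebra_def)
    have hI: "Poly_Mapping.single 0 c * h \<in> I" using I_l_closed[OF h(1) cs] by (simp add: free_algebra_def)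
    have "I +>\<^bsub>free_algebra G\<^esub> (Poly_Mapping.single 0 c * x) = I +>\<^bsub>free_algebra G\<^esub> (Poly_Mapping.single 0 c * p)"
    proof (rule a_repr_independence[symmetric])
      show "Poly_Mapping.single 0 c * x \<in> I +>\<^bsub>free_algebra G\<^esub> (Poly_Mapping.single 0 c * p)"
        using hI h(2) by (auto simp: a_r_coset_def' free_algebra_def distrib_left)
      show "Poly_Mapping.single 0 c * p \<in> carrier (free_algebra G)"
        using m_closed[OF cs assms(2)] by (simp add: free_algebra_def)
    qed (rule a_subgroup) }
  note * = this
  have pin: "p \<in> I +>\<^bsub>free_algebra G\<^esub> p" using a_rcos_self[OF assms(2)] .
  have "smult (free_algebra G) c x = Poly_Mapping.single 0 c * x" for x by (simp add: free_algebra_def)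
  then have "c \<odot>\<^bsub>quotient_algebra (free_algebra G) I\<^esub> (I +>\<^bsub>free_algebra G\<^esub> p) =
      (\<Union>x\<in>I +>\<^bsub>free_algebra G\<^esub> p. I +>\<^bsub>free_algebra G\<^esub> (Poly_Mapping.single 0 c * x))"
    by (simp add: quotient_algebra_def ring.defs module.defs)
  also have "\<dots> = I +>\<^bsub>free_algebra G\<^esub> (Poly_Mapping.single 0 c * p)"
    by (rule SUP_eq_const) (use pin * in blast)+
  finally show ?thesis .
qed

section \<open>Representations\<close>

text \<open>
  All representation spaces below are subspaces of spaces \<^typ>\<open>'i \<Rightarrow> complex\<close> of functions,
  with pointwise operations.
\<close>

definition cscale :: "complex \<Rightarrow> ('i \<Rightarrow> complex) \<Rightarrow> 'i \<Rightarrow> complex" where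
  "cscale c v = (\<lambda>i. c * v i)"

global_interpretation cfun: vector_space "cscale :: complex \<Rightarrow> ('i \<Rightarrow> complex) \<Rightarrow> 'i \<Rightarrow> complex"
  by standard (auto simp: cscale_def algebra_simps)

definition lin_op_on :: "('i \<Rightarrow> complex) set \<Rightarrow> (('i \<Rightarrow> complex) \<Rightarrow> 'i \<Rightarrow> complex) \<Rightarrow> bool" where
  "lin_op_on W f \<longleftrightarrow>
     (\<forall>v\<in>W. f v \<in> W) \<and>
     (\<forall>v\<in>W. \<forall>w\<in>W. f (v + w) = f v + f w) \<and>
     (\<forall>c. \<forall>v\<in>W. f (cscale c v) = cscale c (f v))"

definition algebra_rep ::
    "(complex, 'a) module \<Rightarrow> ('i \<Rightarrow> complex) set \<Rightarrow> ('a \<Rightarrow> ('i \<Rightarrow> complex) \<Rightarrow> 'i \<Rightarrow> complex) \<Rightarrow> bool"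
  where
  "algebra_rep A W \<rho> \<longleftrightarrow>
     cfun.subspace W \<and>
     (\<forall>a\<in>carrier A. lin_op_on W (\<rho> a)) \<and>
     (\<forall>w\<in>W. \<rho> \<one>\<^bsub>A\<^esub> w = w) \<and>
     (\<forall>a\<in>carrier A. \<forall>b\<in>carrier A. \<forall>w\<in>W. \<rho> (a \<otimes>\<^bsub>A\<^esub> b) w = \<rho> a (\<rho> b w)) \<and>
     (\<forall>a\<in>carrier A. \<forall>b\<in>carrier A. \<forall>w\<in>W. \<rho> (a \<oplus>\<^bsub>A\<^esub> b) w = \<rho> a w + \<rho> b w) \<and>
     (\<forall>c. \<forall>a\<in>carrier A. \<forall>w\<in>W. \<rho> (c \<odot>\<^bsub>A\<^esub> a) w = cscale c (\<rho> a w))"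

definition irreducible_under ::
    "(('i \<Rightarrow> complex) \<Rightarrow> 'i \<Rightarrow> complex) set \<Rightarrow> ('i \<Rightarrow> complex) set \<Rightarrow> bool" where
  "irreducible_under F W \<longleftrightarrow>
     W \<noteq> {0} \<and>
     (\<forall>U. cfun.subspace U \<longrightarrow> U \<subseteq> W \<longrightarrow> (\<forall>f\<in>F. f ` U \<subseteq> U) \<longrightarrow> U = {0} \<or> U = W)"

definition irreducible_rep ::
    "(complex, 'a) module \<Rightarrow> ('i \<Rightarrow> complex) set \<Rightarrow> ('a \<Rightarrow> ('i \<Rightarrow> complex) \<Rightarrow> 'i \<Rightarrow> complex) \<Rightarrow> bool"
  where
  "irreducible_rep A W \<rho> \<longleftrightarrow> algebra_rep A W \<rho> \<and> irreducible_under (\<rho> ` carrier A) W"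

definition simultaneously_diagonal ::
    "(('i \<Rightarrow> complex) \<Rightarrow> 'i \<Rightarrow> complex) set \<Rightarrow> ('i \<Rightarrow> complex) set \<Rightarrow> bool" where
  "simultaneously_diagonal F W \<longleftrightarrow>
     (\<exists>B. cfun.independent B \<and> cfun.span B = W \<and> (\<forall>f\<in>F. \<forall>b\<in>B. \<exists>c. f b = cscale c b))"

text \<open>
  The value of a noncommutative polynomial at operators \<open>f g\<close>, where \<open>g\<close> ranges over the
  generators.  By the universal property \<open>presented_algebra_rep\<close> below, operators satisfying the
  relations define a representation of the presented algebra.
\<close>

definition wop ::
    "('g \<Rightarrow> ('i \<Rightarrow> complex) \<Rightarrow> 'i \<Rightarrow> complex) \<Rightarrow> 'g fword \<Rightarrow> ('i \<Rightarrow> complex) \<Rightarrow> 'i \<Rightarrow> complex"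
  where "wop f u w = foldr f (letters u) w"

definition evalp ::
    "('g \<Rightarrow> ('i \<Rightarrow> complex) \<Rightarrow> 'i \<Rightarrow> complex) \<Rightarrow> ('g fword \<Rightarrow>\<^sub>0 complex) \<Rightarrow>
      ('i \<Rightarrow> complex) \<Rightarrow> 'i \<Rightarrow> complex"
  where
  "evalp f p w =
     (\<Sum>u\<in>Poly_Mapping.keys p. cscale (Poly_Mapping.lookup p u) (wop f u w))"

lemma evalp_superset: "finite K \<Longrightarrow> Poly_Mapping.keys p \<subseteq> K \<Longrightarrow> evalp f p w = (\<Sum>u\<in>K. cscale (Poly_Mapping.lookup p u) (wop f u w))"
  unfolding evalp_def by (rule sum.mono_neutral_left) (auto simp: in_keys_iff cscale_def fun_eq_iff)

lemma evalp_add: "evalp f (p + q) w = evalp f p w + evalp f q w"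
proof -
  let ?K = "Poly_Mapping.keys p \<union> Poly_Mapping.keys q"
  have "Poly_Mapping.keys (p+q) \<subseteq> ?K" by (rule Poly_Mapping.keys_add)
  then show ?thesis
    by (simp add: evalp_superset[of ?K] lookup_add cfun.scale_left_distrib sum.distrib)
qed

lemma evalp_0: "evalp f 0 w = 0" by (simp add: evalp_def)

lemma evalp_uminus: "evalp f (-p) w = - evalp f p w"
  using evalp_add[of f p "-p" w] by (simp add: evalp_0 eq_neg_iff_add_eq_0 add.commute)

lemma evalp_diff: "evalp f (p - q) w = evalp f p w - evalp f q w"
  using evalp_add[of f p "-q" w] by (simp add: evalp_uminus)

lemma evalp_sum: "evalp f (sum g A) w = (\<Sum>a\<in>A. evalp f (g a) w)"
  by (induction A rule: infinite_finite_induct) (auto simp: evalp_0 evalp_add)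

lemma evalp_single: "evalp f (Poly_Mapping.single u c) w = cscale c (wop f u w)"
  by (cases "c = 0") (auto simp: evalp_def cscale_def fun_eq_iff)

lemma poly_mapping_monomials: "p = (\<Sum>u\<in>Poly_Mapping.keys p. Poly_Mapping.single u (Poly_Mapping.lookup p u))"
  by (rule poly_mapping_eqI) (auto simp: lookup_sum lookup_single when_def in_keys_iff sum.delta)

lemma lin_op_on_sum:
  assumes "cfun.subspace W" "lin_op_on W g" "\<And>a. a \<in> A \<Longrightarrow> h a \<in> W"
  shows "g (sum h A) = (\<Sum>a\<in>A. g (h a))"
proof -
  have g0: "g 0 = 0" 
  proof -
    have "g (cscale 0 0) = cscale 0 (g 0)" using assms cfun.subspace_0 unfolding lin_op_on_def by blast
    then show ?thesis by simp
  qed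
  show ?thesis using assms(3)
    by (induction A rule: infinite_finite_induct) (use g0 assms in \<open>auto simp: lin_op_on_def cfun.subspace_sum\<close>)
qed

context
  fixes W :: "('i \<Rightarrow> complex) set" and G :: "'g set" and f
  assumes W: "cfun.subspace W" and f: "\<And>g. g \<in> G \<Longrightarrow> lin_op_on W (f g)"
begin

lemma lin_wop: "set (letters u) \<subseteq> G \<Longrightarrow> lin_op_on W (wop f u)"
proof -
  have "set l \<subseteq> G \<Longrightarrow> lin_op_on W (foldr f l)" for l
  proof (induction l)
    case Nil then show ?case by (simp add: lin_op_on_def)
  next
    case (Cons a l) then show ?case using f[of a] by (simp add: lin_op_on_def)
  qed
  moreover assume "set (letters u) \<subseteq> G"
  ultimately show ?thesis by (simp add: wop_def[abs_def])
qed

lemma wop_mult: "wop f (u + v) w = wop f u (wop f v w)"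
  by (simp add: wop_def plus_fword_def)

lemma lin_evalp: "p \<in> carrier (free_algebra G) \<Longrightarrow> lin_op_on W (evalp f p)"
proof -
  assume p: "p \<in> carrier (free_algebra G)"
  have l: "lin_op_on W (wop f u)" if "u \<in> Poly_Mapping.keys p" for u
    using p lin_wop that by (auto simp: free_algebra_def)
  show ?thesis
    unfolding lin_op_on_def evalp_def
  proof (intro conjI ballI allI)
    fix v assume "v \<in> W" then show "(\<Sum>u\<in>Poly_Mapping.keys p. cscale (Poly_Mapping.lookup p u) (wop f u v)) \<in> W"
      using l W by (auto simp: lin_op_on_def intro!: cfun.subspace_sum cfun.subspace_scale)
  next
    fix v w assume "v \<in> W" "w \<in> W" then show "(\<Sum>u\<in>Poly_Mapping.keys p. cscale (Poly_Mapping.lookup p u) (wop f u (v+w))) = (\<Sum>u\<in>Poly_Mapping.keys p. cscale (Poly_Mapping.lookup p u) (wop f u v)) + (\<Sum>u\<in>Poly_Mapping.keys p. cscale (Poly_Mapping.lookup p u) (wop f u w))"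
      using l unfolding sum.distrib[symmetric] lin_op_on_def
      by (intro sum.cong) (auto simp: cfun.scale_right_distrib)
  next
    fix c v assume "v \<in> W" then show "(\<Sum>u\<in>Poly_Mapping.keys p. cscale (Poly_Mapping.lookup p u) (wop f u (cscale c v))) = cscale c (\<Sum>u\<in>Poly_Mapping.keys p. cscale (Poly_Mapping.lookup p u) (wop f u v))"
      using l unfolding cfun.scale_sum_right lin_op_on_def
      by (intro sum.cong) (auto simp: mult.commute)
  qed
qed

lemma evalp_mult:
  assumes "p \<in> carrier (free_algebra G)" "q \<in> carrier (free_algebra G)" "w \<in> W"
  shows "evalp f (p * q) w = evalp f p (evalp f q w)"
proof -
  let ?P = "Poly_Mapping.keys p" and ?Q = "Poly_Mapping.keys q"
  have l: "lin_op_on W (wop f u)" if "u \<in> ?P \<union> ?Q" for u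
    using assms lin_wop that by (auto simp: free_algebra_def)
  have "p * q = (\<Sum>u\<in>?P. \<Sum>v\<in>?Q. Poly_Mapping.single (u + v) (Poly_Mapping.lookup p u * Poly_Mapping.lookup q v))"
    by (subst poly_mapping_monomials[of p], subst poly_mapping_monomials[of q]) (simp add: sum_product mult_single)
  then have "evalp f (p * q) w = (\<Sum>u\<in>?P. \<Sum>v\<in>?Q. cscale (Poly_Mapping.lookup p u * Poly_Mapping.lookup q v) (wop f u (wop f v w)))"
    by (simp add: evalp_sum evalp_single wop_mult)
  also have "\<dots> = (\<Sum>u\<in>?P. cscale (Poly_Mapping.lookup p u) (wop f u (evalp f q w)))"
  proof (rule sum.cong[OF refl])
    fix u assume u: "u \<in> ?P"
    have vW: "wop f v w \<in> W" if "v \<in> ?Q" for v using l[of v] that assms(3) by (auto simp: lin_op_on_def)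
    have "wop f u (evalp f q w) = (\<Sum>v\<in>?Q. wop f u (cscale (Poly_Mapping.lookup q v) (wop f v w)))"
      unfolding evalp_def by (rule lin_op_on_sum[OF W l]) (use u vW W cfun.subspace_scale in auto)
    also have "\<dots> = (\<Sum>v\<in>?Q. cscale (Poly_Mapping.lookup q v) (wop f u (wop f v w)))"
      using l[of u] u vW by (intro sum.cong) (auto simp: lin_op_on_def)
    finally show "(\<Sum>v\<in>?Q. cscale (Poly_Mapping.lookup p u * Poly_Mapping.lookup q v) (wop f u (wop f v w))) = cscale (Poly_Mapping.lookup p u) (wop f u (evalp f q w))"
      by (simp add: cfun.scale_sum_right)
  qed
  finally show ?thesis by (simp add: evalp_def)
qed

lemma presented_algebra_rep:
  assumes R: "\<And>p q. R p q \<Longrightarrow> p \<in> carrier (free_algebra G) \<and> q \<in> carrier (free_algebra G) \<and> (\<forall>w\<in>W. evalp f p w = evalp f q w)"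
  shows "\<exists>\<rho>. algebra_rep (presented_algebra G R) W \<rho> \<and>
     (\<forall>p\<in>carrier (free_algebra G). \<forall>w\<in>W. \<rho> (rel_ideal G R +>\<^bsub>free_algebra G\<^esub> p) w = evalp f p w)"
proof -
  let ?F = "free_algebra G"
  interpret ring ?F by (rule ring_free_algebra)
  have Fs: "monoid.mult ?F = (*)" "\<one>\<^bsub>?F\<^esub> = 1" "\<zero>\<^bsub>?F\<^esub> = 0" "add ?F = (+)" by (simp_all add: free_algebra_def)
  have minus: "p - q \<in> carrier ?F" if "p \<in> carrier ?F" "q \<in> carrier ?F" for p q
  proof -
    have "-q \<in> carrier ?F" using that by (simp add: free_algebra_def)
    from add.m_closed[OF that(1) this] show ?thesis by (simp add: Fs)
  qed
  define J where "J = {p \<in> carrier ?F. \<forall>w\<in>W. evalp f p w = 0}"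
  have "ideal J ?F"
  proof (rule idealI[OF ring_free_algebra])
    show "subgroup J (add_monoid ?F)"
    proof (rule add.subgroupI)
      show "J \<noteq> {}" using zero_closed by (auto simp: J_def evalp_0 Fs)
      fix a assume a: "a \<in> J"
      have m: "\<ominus>\<^bsub>?F\<^esub> a = - a"
        by (rule minus_equality) (use a minus[of 0 a] zero_closed in \<open>auto simp: J_def Fs\<close>)
      then show "\<ominus>\<^bsub>?F\<^esub> a \<in> J" using a a_inv_closed[of a] by (auto simp: J_def evalp_uminus)
    qed (use a_closed in \<open>auto simp: J_def Fs evalp_add\<close>)
  next
    fix a x assume a: "a \<in> J" "x \<in> carrier ?F"
    have "lin_op_on W (evalp f x)" by (rule lin_evalp[OF a(2)])
    then have x0: "evalp f x 0 = 0" using lin_op_on_sum[OF W, where A = "{} :: nat set" and h = "\<lambda>_. 0"] by (simp only: sum.empty empty_iff)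
    show "x \<otimes>\<^bsub>?F\<^esub> a \<in> J" using m_closed[of x a] a x0 by (auto simp: J_def Fs evalp_mult)
    show "a \<otimes>\<^bsub>?F\<^esub> x \<in> J" using m_closed[of a x] a lin_evalp[OF a(2)] 
      by (auto simp: J_def Fs evalp_mult lin_op_on_def)
  qed
  moreover have sub: "{p - q |p q. R p q} \<subseteq> J" using R minus by (auto simp: J_def evalp_diff)
  ultimately have IJ: "rel_ideal G R \<subseteq> J" unfolding rel_ideal_def by (rule genideal_minimal)
  have idI: "ideal (rel_ideal G R) ?F" unfolding rel_ideal_def
    by (rule genideal_ideal) (use sub J_def in auto)
  let ?I = "rel_ideal G R"
  interpret I: ideal ?I ?F by (rule idI)
  define \<rho> where "\<rho> X = evalp f (SOME p. p \<in> X)" for X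
  have rho: "\<rho> (?I +>\<^bsub>?F\<^esub> p) w = evalp f p w" if "p \<in> carrier ?F" "w \<in> W" for p w
  proof -
    have "(SOME x. x \<in> ?I +>\<^bsub>?F\<^esub> p) \<in> ?I +>\<^bsub>?F\<^esub> p" using I.a_rcos_self[OF that(1)] by (rule someI)
    then obtain h where "h \<in> ?I" "(SOME x. x \<in> ?I +>\<^bsub>?F\<^esub> p) = h + p" by (auto simp: a_r_coset_def' Fs)
    then show ?thesis using IJ that by (auto simp: \<rho>_def evalp_add J_def)
  qed
  have carr: "carrier (presented_algebra G R) = {?I +>\<^bsub>?F\<^esub> p |p. p \<in> carrier ?F}"
    by (auto simp: presented_algebra_def quotient_algebra_def ring.defs FactRing_def A_RCOSETS_def')
  have ops: "monoid.mult (presented_algebra G R) = monoid.mult (?F Quot ?I)" "one (presented_algebra G R) = one (?F Quot ?I)"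
    "add (presented_algebra G R) = add (?F Quot ?I)"
    by (auto simp: presented_algebra_def quotient_algebra_def ring.defs)
  have ops': "\<one>\<^bsub>?F Quot ?I\<^esub> = ?I +>\<^bsub>?F\<^esub> 1" 
     "\<And>p q. p \<in> carrier ?F \<Longrightarrow> q \<in> carrier ?F \<Longrightarrow> (?I +>\<^bsub>?F\<^esub> p) \<otimes>\<^bsub>?F Quot ?I\<^esub> (?I +>\<^bsub>?F\<^esub> q) = ?I +>\<^bsub>?F\<^esub> (p * q)"
     "\<And>p q. p \<in> carrier ?F \<Longrightarrow> q \<in> carrier ?F \<Longrightarrow> (?I +>\<^bsub>?F\<^esub> p) \<oplus>\<^bsub>?F Quot ?I\<^esub> (?I +>\<^bsub>?F\<^esub> q) = ?I +>\<^bsub>?F\<^esub> (p + q)"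
    using I.rcoset_mult_add I.a_rcos_sum by (auto simp: FactRing_def Fs)
  have c1: "1 \<in> carrier ?F" "\<And>c. Poly_Mapping.single 0 c \<in> carrier ?F"
    using one_closed by (auto simp: Fs) (auto simp: free_algebra_def zero_fword_def)
  have cm: "p * q \<in> carrier ?F" "p + q \<in> carrier ?F" if "p \<in> carrier ?F" "q \<in> carrier ?F" for p q
    using that m_closed[of p q] a_closed[of p q] by (auto simp: Fs)
  have one: "evalp f 1 w = w" for w
    unfolding single_one[symmetric] evalp_single by (simp add: wop_def zero_fword_def)
  have scal: "evalp f (Poly_Mapping.single 0 c * p) w = cscale c (evalp f p w)" if "p \<in> carrier ?F" "w \<in> W" for c p w
    unfolding evalp_mult[OF c1(2) that] evalp_single by (simp add: wop_def zero_fword_def)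
  have "algebra_rep (presented_algebra G R) W \<rho>"
    unfolding algebra_rep_def ops
  proof (intro conjI ballI allI)
    fix a assume "a \<in> carrier (presented_algebra G R)"
    then obtain p where p: "p \<in> carrier ?F" "a = ?I +>\<^bsub>?F\<^esub> p" by (auto simp: carr)
    then show "lin_op_on W (\<rho> a)"
      using lin_evalp[OF p(1)] cfun.subspace_add[OF W] cfun.subspace_scale[OF W]
      by (auto simp: lin_op_on_def rho)
    fix c w assume w: "w \<in> W"
    show "\<rho> (c \<odot>\<^bsub>presented_algebra G R\<^esub> a) w = cscale c (\<rho> a w)"
      unfolding presented_algebra_def p smult_quotient[OF idI p(1)]
      using p w cm[OF c1(2) p(1), of c] by (simp add: rho scal)
  next
    fix a b w assume "a \<in> carrier (presented_algebra G R)" "b \<in> carrier (presented_algebra G R)" and w: "w \<in> W"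
    then obtain p q where p: "p \<in> carrier ?F" "a = ?I +>\<^bsub>?F\<^esub> p" and q: "q \<in> carrier ?F" "b = ?I +>\<^bsub>?F\<^esub> q" by (auto simp: carr)
    have "evalp f q w \<in> W" using lin_evalp[OF q(1)] w by (auto simp: lin_op_on_def)
    with p q w show "\<rho> (a \<otimes>\<^bsub>?F Quot ?I\<^esub> b) w = \<rho> a (\<rho> b w)" "\<rho> (a \<oplus>\<^bsub>?F Quot ?I\<^esub> b) w = \<rho> a w + \<rho> b w"
      by (simp_all add: ops' rho cm evalp_mult evalp_add)
  qed (use W in \<open>auto simp: ops' rho one c1\<close>)
  then show ?thesis using rho by blast
qed

end

section \<open>The degenerate affine periplectic Brauer algebra\<close>

datatype gen = Gs nat | Ge nat | Gy nat

definition V_gens :: "nat \<Rightarrow> gen set" where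
  "V_gens n = Gs ` {1..<n} \<union> Ge ` {1..<n} \<union> Gy ` {1..n}"

context
begin

private abbreviation (input) "s i \<equiv> free_gen (Gs i)"
private abbreviation (input) "e i \<equiv> free_gen (Ge i)"
private abbreviation (input) "y i \<equiv> free_gen (Gy i)"

inductive V_rel :: "nat \<Rightarrow> (gen fword \<Rightarrow>\<^sub>0 complex) \<Rightarrow> (gen fword \<Rightarrow>\<^sub>0 complex) \<Rightarrow> bool"
  for n :: nat where
  ss: "i \<in> {1..<n} \<Longrightarrow> V_rel n (s i * s i) 1"
| s_s_far: "i \<in> {1..<n} \<Longrightarrow> j \<in> {1..<n} \<Longrightarrow> \<bar>int i - int j\<bar> > 1 \<Longrightarrow> V_rel n (s i * s j) (s j * s i)"
| s_e_far: "i \<in> {1..<n} \<Longrightarrow> j \<in> {1..<n} \<Longrightarrow> \<bar>int i - int j\<bar> > 1 \<Longrightarrow> V_rel n (s i * e j) (e j * s i)"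
| e_e_far: "i \<in> {1..<n} \<Longrightarrow> j \<in> {1..<n} \<Longrightarrow> \<bar>int i - int j\<bar> > 1 \<Longrightarrow> V_rel n (e i * e j) (e j * e i)"
| braid: "1 \<le> i \<Longrightarrow> i + 1 < n \<Longrightarrow> V_rel n (s i * s (i+1) * s i) (s (i+1) * s i * s (i+1))"
| y_y: "i \<in> {1..n} \<Longrightarrow> j \<in> {1..n} \<Longrightarrow> V_rel n (y i * y j) (y j * y i)"
| e_y_far: "i \<in> {1..<n} \<Longrightarrow> j \<in> {1..n} \<Longrightarrow> j \<noteq> i \<Longrightarrow> j \<noteq> i + 1 \<Longrightarrow> V_rel n (e i * y j) (y j * e i)"
| s_y_far: "i \<in> {1..<n} \<Longrightarrow> j \<in> {1..n} \<Longrightarrow> j \<noteq> i \<Longrightarrow> j \<noteq> i + 1 \<Longrightarrow> V_rel n (s i * y j) (y j * s i)"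
| eee_up: "1 \<le> i \<Longrightarrow> i + 1 < n \<Longrightarrow> V_rel n (e (i+1) * e i * e (i+1)) (- e (i+1))"
| eee_down: "1 \<le> i \<Longrightarrow> i + 1 < n \<Longrightarrow> V_rel n (e i * e (i+1) * e i) (- e i)"
| es: "i \<in> {1..<n} \<Longrightarrow> V_rel n (e i * s i) (e i)"
| se: "i \<in> {1..<n} \<Longrightarrow> V_rel n (s i * e i) (- e i)"
| see_down: "1 \<le> i \<Longrightarrow> i + 1 < n \<Longrightarrow> V_rel n (s i * e (i+1) * e i) (s (i+1) * e i)"
| see_up: "1 \<le> i \<Longrightarrow> i + 1 < n \<Longrightarrow> V_rel n (s (i+1) * e i * e (i+1)) (- (s i * e (i+1)))"
| ees_up: "1 \<le> i \<Longrightarrow> i + 1 < n \<Longrightarrow> V_rel n (e (i+1) * e i * s (i+1)) (e (i+1) * s i)"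
| ees_down: "1 \<le> i \<Longrightarrow> i + 1 < n \<Longrightarrow> V_rel n (e i * e (i+1) * s i) (- (e i * s (i+1)))"
| ee: "i \<in> {1..<n} \<Longrightarrow> V_rel n (e i * e i) 0"
| s_y: "i \<in> {1..<n} \<Longrightarrow> V_rel n (s i * y i - y (i+1) * s i) (- e i - 1)"
| y_s: "i \<in> {1..<n} \<Longrightarrow> V_rel n (y i * s i - s i * y (i+1)) (e i - 1)"
| e_y: "i \<in> {1..<n} \<Longrightarrow> V_rel n (e i * (y i - y (i+1))) (- e i)"
| y_e: "i \<in> {1..<n} \<Longrightarrow> V_rel n ((y i - y (i+1)) * e i) (e i)"

end

text \<open>The relators lie in the free algebra, so that \<^const>\<open>rel_ideal\<close> is indeed an ideal of it.\<close>

lemma V_rel_carrier: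
  "V_rel n p q \<Longrightarrow>
     p \<in> carrier (free_algebra (V_gens n)) \<and> q \<in> carrier (free_algebra (V_gens n))"
  by (induction rule: V_rel.induct)
    (auto intro!: free_algebra_closed simp: V_gens_def)

definition V_alg :: "nat \<Rightarrow> (complex, (gen fword \<Rightarrow>\<^sub>0 complex) set) module" where
  "V_alg n = presented_algebra (V_gens n) (V_rel n)"

definition V_gen :: "nat \<Rightarrow> gen \<Rightarrow> (gen fword \<Rightarrow>\<^sub>0 complex) set" where
  "V_gen n g = rel_ideal (V_gens n) (V_rel n) +>\<^bsub>free_algebra (V_gens n)\<^esub> free_gen g"

definition A_alg :: "nat \<Rightarrow> (complex, (gen fword \<Rightarrow>\<^sub>0 complex) set) module" where
  "A_alg n = (V_alg n)
     \<lparr>carrier := gen_subalgebra (V_alg n) (V_gen n ` (Gs ` {1..<n} \<union> Ge ` {1..<n}))\<rparr>"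

text \<open>The Jucys-Murphy elements have indices \<open>1, \<dots>, n\<close>; the value at index \<open>0\<close> is a dummy.\<close>

fun JM :: "nat \<Rightarrow> nat \<Rightarrow> (gen fword \<Rightarrow>\<^sub>0 complex) set" where
  "JM n 0 = \<zero>\<^bsub>A_alg n\<^esub>"
| "JM n (Suc 0) = \<zero>\<^bsub>A_alg n\<^esub>"
| "JM n (Suc (Suc j)) =
     V_gen n (Gs (Suc j)) \<otimes>\<^bsub>A_alg n\<^esub> JM n (Suc j) \<otimes>\<^bsub>A_alg n\<^esub> V_gen n (Gs (Suc j))
       \<oplus>\<^bsub>A_alg n\<^esub> V_gen n (Gs (Suc j)) \<oplus>\<^bsub>A_alg n\<^esub> V_gen n (Ge (Suc j))"

definition calibrated_V_rep ::
    "nat \<Rightarrow> ('i \<Rightarrow> complex) set \<Rightarrow> ((gen fword \<Rightarrow>\<^sub>0 complex) set \<Rightarrow> ('i \<Rightarrow> complex) \<Rightarrow> 'i \<Rightarrow> complex) \<Rightarrow> bool"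
  where
  "calibrated_V_rep n W \<rho> \<longleftrightarrow>
     algebra_rep (V_alg n) W \<rho> \<and>
     simultaneously_diagonal ((\<lambda>j. \<rho> (V_gen n (Gy j))) ` {1..n}) W"

definition calibrated_A_rep ::
    "nat \<Rightarrow> ('i \<Rightarrow> complex) set \<Rightarrow> ((gen fword \<Rightarrow>\<^sub>0 complex) set \<Rightarrow> ('i \<Rightarrow> complex) \<Rightarrow> 'i \<Rightarrow> complex) \<Rightarrow> bool"
  where
  "calibrated_A_rep n W \<rho> \<longleftrightarrow>
     algebra_rep (A_alg n) W \<rho> \<and>
     simultaneously_diagonal ((\<lambda>j. \<rho> (JM n j)) ` {1..n}) W"

section \<open>Exterior powers of the standard representation\<close>

text \<open>
  Vectors of \<open>\<complex>\<^sup>n\<close> are functions on \<^typ>\<open>nat\<close> vanishing outside \<open>{1..n}\<close>.  The irreducible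
  representation of \<open>S\<^sub>n\<close> labeled by \<open>(n - 1, 1)\<close> is the sum-zero subspace of the permutation
  representation \<open>\<complex>\<^sup>n\<close>.
\<close>

definition std_rep :: "nat \<Rightarrow> (nat \<Rightarrow> complex) set" where
  "std_rep n = {v. (\<forall>i. i \<notin> {1..n} \<longrightarrow> v i = 0) \<and> (\<Sum>i\<in>{1..n}. v i) = 0}"

text \<open>
  A tensor of degree \<open>k\<close> is the function of its coordinates, indexed by lists of length \<open>k\<close>.
  As the ground field has characteristic zero, the \<open>k\<close>-th exterior power of a subspace \<open>V\<close> is
  realised inside the \<open>k\<close>-th tensor power as the span of the
  \<open>v\<^sub>1 \<and> \<dots> \<and> v\<^sub>k = (\<Sum>\<sigma>. sign \<sigma> \<cdot> v\<^sub>\<sigma>\<^sub>(\<^sub>1\<^sub>) \<otimes> \<dots> \<otimes> v\<^sub>\<sigma>\<^sub>(\<^sub>k\<^sub>))\<close>.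
\<close>

definition wedge :: "('x \<Rightarrow> complex) list \<Rightarrow> 'x list \<Rightarrow> complex" where
  "wedge vs = (\<lambda>xs. if length xs = length vs
     then \<Sum>\<sigma> | \<sigma> permutes {..<length vs}.
            of_int (sign \<sigma>) * (\<Prod>a<length vs. (vs ! \<sigma> a) (xs ! a))
     else 0)"

definition ext_power :: "nat \<Rightarrow> ('x \<Rightarrow> complex) set \<Rightarrow> ('x list \<Rightarrow> complex) set" where
  "ext_power k V = cfun.span {wedge vs |vs. length vs = k \<and> set vs \<subseteq> V}"

definition perm_vec :: "('x \<Rightarrow> 'x) \<Rightarrow> ('x \<Rightarrow> complex) \<Rightarrow> 'x \<Rightarrow> complex" where
  "perm_vec p v = (\<lambda>x. v (inv_into UNIV p x))"

definition perm_tensor :: "('x \<Rightarrow> 'x) \<Rightarrow> ('x list \<Rightarrow> complex) \<Rightarrow> 'x list \<Rightarrow> complex" where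
  "perm_tensor p T = (\<lambda>xs. T (map (inv_into UNIV p) xs))"

lemma perm_tensor_wedge: "perm_tensor p (wedge vs) = wedge (map (perm_vec p) vs)"
proof
  fix xs :: "'a list"
  have "(vs ! \<sigma> a) (inv_into UNIV p (xs ! a)) = (map (perm_vec p) vs ! \<sigma> a) (xs ! a)"
    if "\<sigma> permutes {..<length vs}" "a < length vs" for \<sigma> a
    using permutes_in_image[OF that(1), of a] that(2) by (simp add: perm_vec_def)
  then show "perm_tensor p (wedge vs) xs = wedge (map (perm_vec p) vs) xs"
    by (auto simp: perm_tensor_def wedge_def intro!: sum.cong prod.cong arg_cong2[of _ _ _ _ "(*)"])
qed

lemma perm_vec_std_rep:
  assumes "p permutes {1..n}" "v \<in> std_rep n"
  shows "perm_vec p v \<in> std_rep n"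
proof -
  have "(\<Sum>i\<in>{1..n}. v (inv_into UNIV p i)) = (\<Sum>i\<in>{1..n}. v i)"
    using sum.permute[OF permutes_inv[OF assms(1)], of v] by (simp add: o_def)
  moreover have "inv_into UNIV p i \<notin> {1..n}" if "i \<notin> {1..n}" for i
    using permutes_in_image[OF permutes_inv[OF assms(1)]] that by blast
  ultimately show ?thesis
    using assms(2) by (simp add: std_rep_def perm_vec_def)
qed

lemma perm_tensor_ext_power:
  assumes "p permutes {1..n}" "T \<in> ext_power k (std_rep n)"
  shows "perm_tensor p T \<in> ext_power k (std_rep n)"
  using assms(2) unfolding ext_power_def
proof (induction rule: cfun.span_induct_alt)
  case base
  then show ?case
    using cfun.span_zero by (simp add: perm_tensor_def zero_fun_def)
next
  case (step c T U)
  from step(1) obtain vs where vs: "T = wedge vs" "length vs = k" "set vs \<subseteq> std_rep n" by blast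
  have "perm_tensor p T \<in> {wedge vs |vs. length vs = k \<and> set vs \<subseteq> std_rep n}"
    unfolding vs(1) perm_tensor_wedge using vs perm_vec_std_rep[OF assms(1)]
    by (intro CollectI exI[of _ "map (perm_vec p) vs"]) fastforce
  note memb = this
  have eq: "perm_tensor p (cscale c T + U) = cscale c (perm_tensor p T) + perm_tensor p U"
    by (simp add: perm_tensor_def cscale_def fun_eq_iff)
  show ?case
    unfolding eq by (intro cfun.span_add cfun.span_scale cfun.span_base[OF memb] step(2))
qed

end

theory Submission
  imports Defs "Jordan_Normal_Form.Determinant"
begin

text \<open>
  On the exterior algebra of the standard representation let \<open>d\<^sub>i\<close> be multiplication by the simple
  root \<open>\<epsilon>\<^sub>i - \<epsilon>\<^sub>i\<^sub>+\<^sub>1\<close> and \<open>c\<^sub>i\<close> contraction with the dual basis vector \<open>v \<mapsto> v\<^sub>1 + \<dots> + v\<^sub>i\<close>; these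
  satisfy the canonical anticommutation relations, with \<open>c\<^sub>0 = 0\<close>.  The transposition \<open>s\<^sub>i\<close> acts as
  \<open>1 - d\<^sub>i (2 c\<^sub>i - c\<^sub>i\<^sub>-\<^sub>1 - c\<^sub>i\<^sub>+\<^sub>1)\<close>, and the action is extended by
  \<open>e\<^sub>i = d\<^sub>i (c\<^sub>i\<^sub>-\<^sub>1 - c\<^sub>i\<^sub>+\<^sub>1)\<close> and \<open>y\<^sub>j = \<alpha> + j - 1 - 2 (d\<^sub>1 c\<^sub>1 + \<dots> + d\<^sub>j\<^sub>-\<^sub>1 c\<^sub>j\<^sub>-\<^sub>1)\<close>.
  All relations then follow by normal ordering, and the wedges of simple roots are joint
  eigenvectors of the \<open>y\<^sub>j\<close>.

  Irreducibility already holds for \<open>S\<^sub>n\<close>: an invariant subspace is stable under the reflection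
  terms \<open>(\<epsilon>\<^sub>1 - \<epsilon>\<^sub>x) \<otimes> (\<epsilon>\<^sub>1 - \<epsilon>\<^sub>x)\<^sup>*\<close>, whose commutators generate all of \<open>gl(V\<^sub>n)\<close>.  Products of rank one
  elements of \<open>gl(V\<^sub>n)\<close> turn any nonzero vector into any pure wedge.
\<close>

section \<open>Exterior multiplication and contraction\<close>

text \<open>Exterior multiplication by \<open>a\<close> without factorial normalization. The
  recursion is the antiderivation rule for contraction, read off in the first slot.\<close>

fun lwedge :: "('x \<Rightarrow> complex) \<Rightarrow> ('x list \<Rightarrow> complex) \<Rightarrow> 'x list \<Rightarrow> complex" where
  "lwedge a f [] = 0"
| "lwedge a f (x # xs) = a x * f xs - lwedge a (\<lambda>ys. f (x # ys)) xs"

definition contr :: "'x \<Rightarrow> ('x list \<Rightarrow> complex) \<Rightarrow> 'x list \<Rightarrow> complex" where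
  "contr x f = (\<lambda>ys. f (x # ys))"

definition vac :: "'x list \<Rightarrow> complex" where
  "vac xs = (if xs = [] then 1 else 0)"

lemma cscale_apply: "cscale c f x = c * f x"
  by (simp add: cscale_def)

lemma contr_add: "contr x (f + g) = contr x f + contr x g"
  and contr_diff: "contr x (f - g) = contr x f - contr x g"
  and contr_uminus: "contr x (- f) = - contr x f"
  and contr_scale: "contr x (cscale c f) = cscale c (contr x f)"
  and contr_0: "contr x 0 = 0"
  by (simp_all add: contr_def cscale_def fun_eq_iff)

lemma contr_sum: "contr x (\<Sum>i\<in>A. f i) = (\<Sum>i\<in>A. contr x (f i))"
  by (induction A rule: infinite_finite_induct)
    (simp_all only: sum.infinite sum.empty sum.insert not_False_eq_True contr_0 contr_add)

lemma lwedge_Cons: "lwedge a f (x # xs) = a x * f xs - lwedge a (contr x f) xs"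
  by (simp add: contr_def)

lemma contr_lwedge: "contr x (lwedge a f) = cscale (a x) f - lwedge a (contr x f)"
  by (simp add: contr_def cscale_def fun_eq_iff)

lemma contr_vac: "contr x vac = 0"
  by (simp add: contr_def vac_def fun_eq_iff)

lemma lwedge_add: "lwedge a (f + g) = lwedge a f + lwedge a g"
proof
  show "lwedge a (f + g) xs = (lwedge a f + lwedge a g) xs" for xs
    by (induction xs arbitrary: f g)
      (simp_all add: lwedge_Cons contr_add distrib_left del: lwedge.simps(2))
qed

lemma lwedge_scale: "lwedge a (cscale c f) = cscale c (lwedge a f)"
proof
  show "lwedge a (cscale c f) xs = cscale c (lwedge a f) xs" for xs
    by (induction xs arbitrary: f)
      (simp_all add: lwedge_Cons contr_scale cscale_apply right_diff_distrib del: lwedge.simps(2))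
qed

lemma lwedge_0: "lwedge a 0 = 0"
  using lwedge_scale[of a 0 0] by simp

lemma lwedge_uminus: "lwedge a (- f) = - lwedge a f"
  using lwedge_add[of a f "- f"] by (simp add: lwedge_0 eq_neg_iff_add_eq_0 add.commute)

lemma lwedge_diff: "lwedge a (f - g) = lwedge a f - lwedge a g"
  using lwedge_add[of a f "- g"] by (simp add: lwedge_uminus)

lemma lwedge_sum: "lwedge a (\<Sum>i\<in>A. f i) = (\<Sum>i\<in>A. lwedge a (f i))"
  by (induction A rule: infinite_finite_induct)
    (simp_all only: sum.infinite sum.empty sum.insert not_False_eq_True lwedge_0 lwedge_add)

lemma lwedge_add_left: "lwedge (a + b) f = lwedge a f + lwedge b f"
proof
  show "lwedge (a + b) f xs = (lwedge a f + lwedge b f) xs" for xs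
    by (induction xs arbitrary: f) (simp_all add: distrib_right)
qed

lemma lwedge_scale_left: "lwedge (cscale c a) f = cscale c (lwedge a f)"
proof
  show "lwedge (cscale c a) f xs = cscale c (lwedge a f) xs" for xs
    by (induction xs arbitrary: f) (simp_all add: cscale_def right_diff_distrib)
qed

lemma lwedge_0_left: "lwedge 0 f = 0"
  using lwedge_scale_left[of 0 0 f] by simp

text \<open>Splitting off the first slot with \<open>contr_lwedge\<close> leaves
  \<open>a x * lwedge b f - b x * lwedge a f\<close>, antisymmetric in \<open>a\<close> and
  \<open>b\<close>, plus the same double product applied to \<open>contr x f\<close>.\<close>

lemma lwedge_anticomm: "lwedge a (lwedge b f) = - lwedge b (lwedge a f)"
proof
  show "lwedge a (lwedge b f) xs = (- lwedge b (lwedge a f)) xs" for xs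
    by (induction xs arbitrary: f)
      (simp_all add: lwedge_Cons contr_lwedge lwedge_diff lwedge_scale cscale_apply
        del: lwedge.simps(2))
qed

lemma lwedge_lwedge: "lwedge a (lwedge a f) = 0"
proof -
  have "lwedge a (lwedge a f) xs = - lwedge a (lwedge a f) xs" for xs
    using lwedge_anticomm[of a a f] by (simp add: fun_eq_iff)
  then show ?thesis
    by (auto simp: fun_eq_iff)
qed

section \<open>Pure wedges as iterated exterior products\<close>

lemma lwedge_conv_sum:
  "lwedge a f xs =
     (\<Sum>i<length xs. (- 1) ^ i * a (xs ! i) * f (take i xs @ drop (Suc i) xs))"
proof (induction xs arbitrary: f)
  case (Cons x xs)
  show ?case
    unfolding lwedge_Cons Cons.IH
    by (simp add: sum.lessThan_Suc_shift contr_def sum_negf del: sum.lessThan_Suc)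
qed simp

lemma wedge_eq_det:
  assumes "length xs = length vs"
  shows "wedge vs xs =
    det (mat (length vs) (length vs) (\<lambda>(i, j). (vs ! j) (xs ! i)))"
proof -
  have "(\<Prod>i<length vs. (vs ! p i) (xs ! i)) =
      (\<Prod>i<length vs. mat (length vs) (length vs) (\<lambda>(i, j). (vs ! j) (xs ! i)) $$ (i, p i))"
    if "p permutes {..<length vs}" for p
    using permutes_in_image[OF that] by (intro prod.cong) auto
  then show ?thesis
    using assms by (simp add: wedge_def det_def atLeast0LessThan)
qed

text \<open>Laplace expansion along the first column, which holds the values of \<open>v\<close>;
  the minors are the wedges of the remaining vectors at \<open>xs\<close> with entry
  \<open>i\<close> removed.\<close>

lemma wedge_Cons: "wedge (v # vs) = lwedge v (wedge vs)"
proof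
  fix xs :: "'a list"
  let ?k = "length vs"
  show "wedge (v # vs) xs = lwedge v (wedge vs) xs"
  proof (cases "length xs = Suc ?k")
    case False
    then show ?thesis
      by (cases xs) (auto simp: lwedge_conv_sum wedge_def)
  next
    case True
    define A where "A = mat (Suc ?k) (Suc ?k) (\<lambda>(i, j). ((v # vs) ! j) (xs ! i))"
    have A: "A \<in> carrier_mat (Suc ?k) (Suc ?k)"
      by (simp add: A_def)
    have "wedge (v # vs) xs = det A"
      using True by (simp add: wedge_eq_det A_def)
    also have "\<dots> = (\<Sum>i<Suc ?k. A $$ (i, 0) * cofactor A i 0)"
      by (rule laplace_expansion_column[OF A]) simp
    also have "\<dots> = (\<Sum>i<Suc ?k. (- 1) ^ i * v (xs ! i) * wedge vs (take i xs @ drop (Suc i) xs))"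
    proof (rule sum.cong[OF refl])
      fix i assume i: "i \<in> {..<Suc ?k}"
      have "mat_delete A i 0 = mat ?k ?k (\<lambda>(a, b). (vs ! b) ((take i xs @ drop (Suc i) xs) ! a))"
        using i True by (auto simp: A_def mat_delete_def nth_append intro!: eq_matI)
      moreover have "length (take i xs @ drop (Suc i) xs) = ?k"
        using i True by simp
      ultimately show "A $$ (i, 0) * cofactor A i 0 =
          (- 1) ^ i * v (xs ! i) * wedge vs (take i xs @ drop (Suc i) xs)"
        using i by (simp add: wedge_eq_det cofactor_def A_def)
    qed
    finally show ?thesis
      by (simp add: lwedge_conv_sum True)
  qed
qed

abbreviation wedges :: "('x \<Rightarrow> complex) list \<Rightarrow> 'x list \<Rightarrow> complex" where
  "wedges vs \<equiv> foldr lwedge vs vac"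

lemma wedge_eq_wedges: "wedge vs = wedges vs"
proof (induction vs)
  case Nil
  show ?case
    by (rule ext) (simp add: wedge_def vac_def)
qed (simp add: wedge_Cons)

section \<open>Alternating tensors\<close>

definition alternating :: "('x list \<Rightarrow> complex) set" where
  "alternating = {f. \<forall>xs x y ys. f (xs @ x # y # ys) = - f (xs @ y # x # ys)}"

lemma alternatingI:
  assumes "\<And>xs x y ys. f (xs @ x # y # ys) = - f (xs @ y # x # ys)"
  shows "f \<in> alternating"
  unfolding alternating_def by (intro CollectI allI assms)

lemma alternatingD:
  assumes "f \<in> alternating"
  shows "f (xs @ x # y # ys) = - f (xs @ y # x # ys)"
  using assms unfolding alternating_def mem_Collect_eq by (elim allE)

lemma alternating_contr:
  assumes "f \<in> alternating"
  shows "contr x f \<in> alternating"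
proof (rule alternatingI)
  show "contr x f (xs @ y # z # ys) = - contr x f (xs @ z # y # ys)" for xs y z ys
    using alternatingD[OF assms, of "x # xs" y z ys] by (simp add: contr_def)
qed

lemma contr_anticomm:
  assumes "f \<in> alternating"
  shows "contr x (contr y f) = - contr y (contr x f)"
proof
  show "contr x (contr y f) xs = (- contr y (contr x f)) xs" for xs
    using alternatingD[OF assms, of "[]" y x xs] by (simp add: contr_def)
qed

lemma subspace_alternating: "cfun.subspace alternating"
proof (rule cfun.subspaceI)
  show "(0 :: 'a list \<Rightarrow> complex) \<in> alternating"
    by (rule alternatingI) simp
next
  fix f g :: "'a list \<Rightarrow> complex" assume fg: "f \<in> alternating" "g \<in> alternating"
  show "f + g \<in> alternating"
  proof (rule alternatingI)
    show "(f + g) (xs @ x # y # ys) = - (f + g) (xs @ y # x # ys)" for xs x y ys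
      using alternatingD[OF fg(1), of xs x y ys] alternatingD[OF fg(2), of xs x y ys] by simp
  qed
next
  fix c and f :: "'a list \<Rightarrow> complex" assume f: "f \<in> alternating"
  show "cscale c f \<in> alternating"
  proof (rule alternatingI)
    show "cscale c f (xs @ x # y # ys) = - cscale c f (xs @ y # x # ys)" for xs x y ys
      using alternatingD[OF f, of xs x y ys] by (simp add: cscale_apply)
  qed
qed

text \<open>Induction on the prefix in front of the swapped pair. At the empty prefix the two terms
  where \<open>a\<close> takes one of the swapped slots are exchanged with a sign, and the rest is
  anticommutation of contractions.\<close>

lemma alternating_lwedge:
  assumes "f \<in> alternating"
  shows "lwedge a f \<in> alternating"
proof -
  have "lwedge a f (xs @ x # y # ys) = - lwedge a f (xs @ y # x # ys)" for xs x y ys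
    using assms
  proof (induction xs arbitrary: f)
    case Nil
    then show ?case
      by (simp add: lwedge_Cons contr_anticomm[of f x y] lwedge_uminus del: lwedge.simps(2))
        (simp add: contr_def)
  next
    case (Cons z xs)
    show ?case
      using Cons.IH[OF alternating_contr[OF Cons.prems]] alternatingD[OF Cons.prems, of xs x y ys]
      by (simp add: lwedge_Cons del: lwedge.simps(2))
  qed
  then show ?thesis
    by (rule alternatingI)
qed

lemma alternating_wedges: "wedges vs \<in> alternating"
proof (induction vs)
  case Nil
  show ?case
    by (rule alternatingI) (simp add: vac_def)
qed (simp add: alternating_lwedge)

section \<open>Creation and annihilation operators for the simple roots\<close>

definition eps :: "'x \<Rightarrow> 'x \<Rightarrow> complex" where
  "eps x = (\<lambda>y. if y = x then 1 else 0)"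

definition cre :: "nat \<Rightarrow> (nat list \<Rightarrow> complex) \<Rightarrow> nat list \<Rightarrow> complex" where
  "cre i = lwedge (eps i - eps (i + 1))"

text \<open>\<open>cre i\<close> and \<open>ann i\<close> are the \<open>d_i\<close> and
  \<open>c_i\<close> of the overview. The partial coordinate sums are dual to the simple roots, and
  the empty sum \<open>ann 0\<close> covers the boundary case \<open>i = 1\<close> of
  \<open>ann (i - 1)\<close>.\<close>

definition ann :: "nat \<Rightarrow> (nat list \<Rightarrow> complex) \<Rightarrow> nat list \<Rightarrow> complex" where
  "ann i f = (\<Sum>x=1..i. contr x f)"

lemma cre_add: "cre i (f + g) = cre i f + cre i g"
  and cre_diff: "cre i (f - g) = cre i f - cre i g"
  and cre_uminus: "cre i (- f) = - cre i f"
  and cre_scale: "cre i (cscale c f) = cscale c (cre i f)"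
  and cre_0: "cre i 0 = 0"
  and cre_sum: "cre i (\<Sum>j\<in>A. h j) = (\<Sum>j\<in>A. cre i (h j))"
  unfolding cre_def by (fact lwedge_add lwedge_diff lwedge_uminus lwedge_scale lwedge_0 lwedge_sum)+

lemma ann_add: "ann i (f + g) = ann i f + ann i g"
  and ann_diff: "ann i (f - g) = ann i f - ann i g"
  and ann_uminus: "ann i (- f) = - ann i f"
  and ann_scale: "ann i (cscale c f) = cscale c (ann i f)"
  and ann_0: "ann i 0 = 0"
  by (simp_all add: ann_def contr_add contr_diff contr_uminus contr_scale contr_0
      sum.distrib sum_subtractf sum_negf cfun.scale_sum_right)

lemma ann_sum: "ann i (\<Sum>j\<in>A. f j) = (\<Sum>j\<in>A. ann i (f j))"
  unfolding ann_def contr_sum by (rule sum.swap)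

lemma ann_index_0: "ann 0 f = 0"
  by (simp add: ann_def)

lemma alternating_ann: "f \<in> alternating \<Longrightarrow> ann i f \<in> alternating"
  unfolding ann_def using subspace_alternating
  by (auto intro!: cfun.subspace_sum alternating_contr)

text \<open>The coordinates \<open>1..i\<close> of \<open>eps j - eps (j + 1)\<close> sum to 1 if
  \<open>i = j\<close> and to 0 otherwise. For \<open>j = 0\<close> this fails, as coordinate 0 lies
  outside the sum.\<close>

lemma ann_cre:
  assumes "0 < j"
  shows "ann i (cre j f) = (if i = j then f else 0) - cre j (ann i f)"
proof -
  have "(\<Sum>x=1..i. (eps j - eps (j + 1)) x) = (if i = j then 1 else 0)"
    using assms by (simp add: eps_def sum_subtractf)
  then have "(\<Sum>x=1..i. cscale ((eps j - eps (j + 1)) x) f) = (if i = j then f else 0)"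
    by (simp add: cfun.scale_sum_left[symmetric])
  then show ?thesis
    by (simp add: ann_def cre_def contr_lwedge sum_subtractf lwedge_sum)
qed

lemma ann_anticomm: 
  assumes "f \<in> alternating"
  shows "ann i (ann j f) = - ann j (ann i f)"
proof -
  have "ann i (ann j f) = (\<Sum>x=1..i. \<Sum>y=1..j. contr x (contr y f))"
    by (simp add: ann_def contr_sum)
  also have "\<dots> = (\<Sum>x=1..i. \<Sum>y=1..j. - contr y (contr x f))"
    by (intro sum.cong refl contr_anticomm assms)
  also have "\<dots> = (\<Sum>y=1..j. \<Sum>x=1..i. - contr y (contr x f))"
    by (rule sum.swap)
  also have "\<dots> = - ann j (ann i f)"
    by (simp add: ann_def contr_sum sum_negf)
  finally show ?thesis .
qed

lemma ann_ann: 
  assumes "f \<in> alternating"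
  shows "ann i (ann i f) = 0"
proof -
  have "ann i (ann i f) xs = - ann i (ann i f) xs" for xs
    using ann_anticomm[OF assms, of i i] by (simp add: fun_eq_iff)
  then show ?thesis
    by (auto simp: fun_eq_iff)
qed

text \<open>The case distinction of \<open>ann_cre\<close> is resolved by the order of the indices,
  so that rewriting produces no conditionals.\<close>

lemma ann_cre_same: "0 < i \<Longrightarrow> ann i (cre i f) = f - cre i (ann i f)"
  and ann_cre_less: "0 < j \<Longrightarrow> i < j \<Longrightarrow> ann i (cre j f) = - cre j (ann i f)"
  and ann_cre_greater: "0 < j \<Longrightarrow> j < i \<Longrightarrow> ann i (cre j f) = - cre j (ann i f)"
  by (simp_all add: ann_cre)

lemma cre_cre: "cre i (cre i f) = 0"
  unfolding cre_def by (rule lwedge_lwedge)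

lemma cre_cre_greater: "j < i \<Longrightarrow> cre i (cre j f) = - cre j (cre i f)"
  unfolding cre_def by (rule lwedge_anticomm)

lemma ann_ann_greater: "f \<in> alternating \<Longrightarrow> j < i \<Longrightarrow> ann i (ann j f) = - ann j (ann i f)"
  by (rule ann_anticomm)

text \<open>
  Normal ordering: creation operators left, annihilation operators right, indices increasing.
  The relations of the algebra become identities between normally ordered expressions.
\<close>

lemmas car_simps = cre_add cre_diff cre_uminus cre_0 ann_add ann_diff ann_uminus ann_0
  ann_cre_same ann_cre_less ann_cre_greater cre_cre cre_cre_greater ann_ann ann_ann_greater
  alternating_ann

text \<open>The inequalities exclude the pairings of \<open>ann x\<close> with \<open>cre j\<close>
  and of \<open>ann y\<close> with \<open>cre i\<close>. What remains is an even number of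
  anticommutations.\<close>

lemma quadratic_comm:
  assumes "f \<in> alternating" "0 < i" "0 < j" "x \<noteq> j" "y \<noteq> i"
  shows "cre i (ann x (cre j (ann y f))) = cre j (ann y (cre i (ann x f)))"
  using assms lwedge_anticomm[of "eps i - eps (i + 1)" "eps j - eps (j + 1)", folded cre_def]
    ann_anticomm[of f x y]
  by (simp add: ann_cre cre_uminus cre_0 cre_diff)

section \<open>The operators for the generators; relations among the \<open>s_i\<close> and
  \<open>e_i\<close>\<close>

definition sop :: "nat \<Rightarrow> (nat list \<Rightarrow> complex) \<Rightarrow> nat list \<Rightarrow> complex" where
  "sop i f = f - cre i (ann i f + ann i f - ann (i - 1) f - ann (i + 1) f)"

definition eop :: "nat \<Rightarrow> (nat list \<Rightarrow> complex) \<Rightarrow> nat list \<Rightarrow> complex" where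
  "eop i f = cre i (ann (i - 1) f - ann (i + 1) f)"

text \<open>Number operator: on a nonzero wedge of simple roots its eigenvalue is the number of
  factors of index below \<open>j\<close>.\<close>

definition num_below :: "nat \<Rightarrow> (nat list \<Rightarrow> complex) \<Rightarrow> nat list \<Rightarrow> complex" where
  "num_below j f = (\<Sum>i=1..<j. cre i (ann i f))"

definition yop :: "complex \<Rightarrow> nat \<Rightarrow> (nat list \<Rightarrow> complex) \<Rightarrow> nat list \<Rightarrow> complex" where
  "yop \<alpha> j f = cscale (\<alpha> + of_nat j - 1) f - (num_below j f + num_below j f)"

text \<open>Symbolic indices \<open>p\<close>, \<open>i\<close>, \<open>j\<close>, \<open>q\<close>
  stand for \<open>i - 1\<close>, \<open>i\<close>, \<open>i + 1\<close>, \<open>i + 2\<close>, so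
  that rewriting orders operators by the assumptions instead of by arithmetic. Only \<open>p\<close>
  may be 0, and it never indexes a creation operator.\<close>

context
  fixes i p j q :: nat and f :: "nat list \<Rightarrow> complex"
  assumes f: "f \<in> alternating"
    and order: "0 < i" "p < i" "p < j" "p < q" "0 < j" "i < j" "i < q" "j < q"
begin

private abbreviation (input) "e1 \<equiv> \<lambda>h. cre i (ann p h - ann j h)"
private abbreviation (input) "e2 \<equiv> \<lambda>h. cre j (ann i h - ann q h)"
private abbreviation (input) "s1 \<equiv> \<lambda>h. h - cre i (ann i h + ann i h - ann p h - ann j h)"
private abbreviation (input) "s2 \<equiv> \<lambda>h. h - cre j (ann j h + ann j h - ann i h - ann q h)"

lemma car_eee_up: "e2 (e1 (e2 f)) = - e2 f"
  using f order by (simp only: car_simps) (simp add: algebra_simps)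

lemma car_eee_down: "e1 (e2 (e1 f)) = - e1 f"
  using f order by (simp only: car_simps) (simp add: algebra_simps)

lemma car_es: "e1 (s1 f) = e1 f"
  using f order by (simp only: car_simps) (simp add: algebra_simps)

lemma car_se: "s1 (e1 f) = - e1 f"
  using f order by (simp only: car_simps) (simp add: algebra_simps)

lemma car_see_down: "s1 (e2 (e1 f)) = s2 (e1 f)"
  using f order by (simp only: car_simps) (simp add: algebra_simps)

lemma car_see_up: "s2 (e1 (e2 f)) = - s1 (e2 f)"
  using f order by (simp only: car_simps) (simp add: algebra_simps)

lemma car_ees_up: "e2 (e1 (s2 f)) = e2 (s1 f)"
  using f order by (simp only: car_simps) (simp add: algebra_simps)

lemma car_ees_down: "e1 (e2 (s1 f)) = - e1 (s2 f)"
  using f order by (simp only: car_simps) (simp add: algebra_simps)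

lemma car_ee: "e1 (e1 f) = 0"
  using f order by (simp only: car_simps) (simp add: algebra_simps)

lemma car_ss: "s1 (s1 f) = f"
  using f order by (simp only: car_simps) (simp add: algebra_simps)

lemma car_braid: "s1 (s2 (s1 f)) = s2 (s1 (s2 f))"
  using f order by (simp only: car_simps) (simp add: algebra_simps)

end

lemma eop_eee_up: "f \<in> alternating \<Longrightarrow> 0 < i \<Longrightarrow> eop (i + 1) (eop i (eop (i + 1) f)) = - eop (i + 1) f"
  and eop_eee_down: "f \<in> alternating \<Longrightarrow> 0 < i \<Longrightarrow> eop i (eop (i + 1) (eop i f)) = - eop i f"
  and eop_sop: "f \<in> alternating \<Longrightarrow> 0 < i \<Longrightarrow> eop i (sop i f) = eop i f"
  and sop_eop: "f \<in> alternating \<Longrightarrow> 0 < i \<Longrightarrow> sop i (eop i f) = - eop i f"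
  and rel_see_down: "f \<in> alternating \<Longrightarrow> 0 < i \<Longrightarrow> sop i (eop (i + 1) (eop i f)) = sop (i + 1) (eop i f)"
  and rel_see_up: "f \<in> alternating \<Longrightarrow> 0 < i \<Longrightarrow> sop (i + 1) (eop i (eop (i + 1) f)) = - sop i (eop (i + 1) f)"
  and rel_ees_up: "f \<in> alternating \<Longrightarrow> 0 < i \<Longrightarrow> eop (i + 1) (eop i (sop (i + 1) f)) = eop (i + 1) (sop i f)"
  and rel_ees_down: "f \<in> alternating \<Longrightarrow> 0 < i \<Longrightarrow> eop i (eop (i + 1) (sop i f)) = - eop i (sop (i + 1) f)"
  and eop_eop: "f \<in> alternating \<Longrightarrow> 0 < i \<Longrightarrow> eop i (eop i f) = 0"
  and sop_sop: "f \<in> alternating \<Longrightarrow> 0 < i \<Longrightarrow> sop i (sop i f) = f"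
  and sop_braid: "f \<in> alternating \<Longrightarrow> 0 < i \<Longrightarrow>
     sop i (sop (i + 1) (sop i f)) = sop (i + 1) (sop i (sop (i + 1) f))"
  using car_eee_up[of f i "i - 1" "i + 1" "i + 2"] car_eee_down[of f i "i - 1" "i + 1" "i + 2"]
    car_es[of f i "i - 1" "i + 1" "i + 2"] car_se[of f i "i - 1" "i + 1" "i + 2"]
    car_see_down[of f i "i - 1" "i + 1" "i + 2"] car_see_up[of f i "i - 1" "i + 1" "i + 2"]
    car_ees_up[of f i "i - 1" "i + 1" "i + 2"] car_ees_down[of f i "i - 1" "i + 1" "i + 2"]
    car_ee[of f i "i - 1" "i + 1" "i + 2"] car_ss[of f i "i - 1" "i + 1" "i + 2"]
    car_braid[of f i "i - 1" "i + 1" "i + 2"]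
  by (simp_all only: eop_def sop_def) (simp_all add: add.commute)

text \<open>All terms are of the form \<open>cre i (ann x _)\<close> and
  \<open>cre j (ann y _)\<close> with \<open>x\<close> within 1 of \<open>i\<close> and
  \<open>y\<close> within 1 of \<open>j\<close>, so \<open>quadratic_comm\<close> applies to each
  pair.\<close>

lemma far_comm:
  assumes "f \<in> alternating" "0 < i" "0 < j" "\<bar>int i - int j\<bar> > 1"
  shows "sop i (sop j f) = sop j (sop i f)"
    and "sop i (eop j f) = eop j (sop i f)"
    and "eop i (eop j f) = eop j (eop i f)"
proof -
  have 1: "cre i (ann (i - 1) (cre j (ann y f))) = cre j (ann y (cre i (ann (i - 1) f)))"
    "cre i (ann i (cre j (ann y f))) = cre j (ann y (cre i (ann i f)))"
    "cre i (ann (i + 1) (cre j (ann y f))) = cre j (ann y (cre i (ann (i + 1) f)))"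
    if "y \<in> {j - 1, j, j + 1}" for y
    using assms that by (auto intro!: quadratic_comm)
  note 2 = 1[of "j - 1", simplified insertI1] 1[of j] 1[of "j + 1"]
  show "sop i (sop j f) = sop j (sop i f)"
    and "sop i (eop j f) = eop j (sop i f)"
    and "eop i (eop j f) = eop j (eop i f)"
    unfolding sop_def eop_def cre_add cre_diff ann_add ann_diff
    using 2 by (simp_all add: algebra_simps)
qed

section \<open>Number operators and the relations of the \<open>y_j\<close>\<close>

lemma two_times_fun: "2 * f = cscale 2 f"
  by (simp add: fun_eq_iff cscale_apply)

lemma num_below_add: "num_below j (f + g) = num_below j f + num_below j g"
  and num_below_diff: "num_below j (f - g) = num_below j f - num_below j g"
  and num_below_scale: "num_below j (cscale c f) = cscale c (num_below j f)"
  by (simp_all add: num_below_def ann_add ann_diff ann_scale cre_add cre_diff cre_scale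
      sum.distrib sum_subtractf cfun.scale_sum_right)

text \<open>Multiplying by a simple root adds one factor. The summand \<open>l = i\<close>
  contributes through its pairing; every other summand passes with two cancelling signs.\<close>

lemma num_below_cre:
  assumes "0 < i"
  shows "num_below j (cre i f) = cre i (num_below j f) + (if i < j then cre i f else 0)"
proof -
  have "cre l (ann l (cre i f)) = (if l = i then cre i f else 0) + cre i (cre l (ann l f))" for l
    using assms lwedge_anticomm[of "eps l - eps (l + 1)" "eps i - eps (i + 1)" "ann l f", folded cre_def]
    by (simp add: ann_cre cre_diff cre_uminus cre_0)
  then show ?thesis
    using assms by (simp add: num_below_def sum.distrib cre_sum sum.delta)
qed

lemma ann_num_below:
  assumes "f \<in> alternating"
  shows "ann i (num_below j f) = num_below j (ann i f) + (if i < j then ann i f else 0)"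
proof -
  have *: "ann i (cre l (ann l f)) = (if l = i then ann i f else 0) + cre l (ann l (ann i f))" if "0 < l" for l
    using that ann_anticomm[OF assms, of i l] by (simp add: ann_cre cre_uminus)
  have "ann i (num_below j f) = (\<Sum>l=1..<j. (if l = i then ann i f else 0) + cre l (ann l (ann i f)))"
    unfolding num_below_def ann_sum by (rule sum.cong) (simp_all add: *)
  also have "\<dots> = num_below j (ann i f) + (if i \<in> {1..<j} then ann i f else 0)"
    by (simp add: num_below_def sum.distrib sum.delta)
  finally show ?thesis
    \<comment> \<open>The sum starts at 1 while the condition \<open>i < j\<close> also admits
      \<open>i = 0\<close>; they agree because \<open>ann 0\<close> vanishes.\<close>
    by (cases "i = 0") (simp_all add: ann_index_0)
qed

lemma num_below_Suc: "0 < j \<Longrightarrow> num_below (Suc j) f = num_below j f + cre j (ann j f)"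
  by (simp add: num_below_def)

lemma num_below_comm:
  assumes "f \<in> alternating"
  shows "num_below i (num_below j f) = num_below j (num_below i f)"
proof -
  have "cre l (ann l (cre m (ann m f))) = cre m (ann m (cre l (ann l f)))" if "0 < l" "0 < m" for l m
    using quadratic_comm[OF assms that] by (cases "l = m") simp_all
  then have "num_below i (num_below j f) = (\<Sum>l=1..<i. \<Sum>m=1..<j. cre m (ann m (cre l (ann l f))))"
    by (simp add: num_below_def ann_sum cre_sum)
  also have "\<dots> = (\<Sum>m=1..<j. \<Sum>l=1..<i. cre m (ann m (cre l (ann l f))))"
    by (rule sum.swap)
  finally show ?thesis
    by (simp add: num_below_def ann_sum cre_sum)
qed

lemma yop_add: "yop \<alpha> j (f + g) = yop \<alpha> j f + yop \<alpha> j g"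
  and yop_diff: "yop \<alpha> j (f - g) = yop \<alpha> j f - yop \<alpha> j g"
  and yop_scale: "yop \<alpha> j (cscale c f) = cscale c (yop \<alpha> j f)"
  by (simp_all add: yop_def num_below_add num_below_diff num_below_scale fun_eq_iff cscale_apply algebra_simps)

lemma yop_cre: "0 < i \<Longrightarrow> yop \<alpha> j (cre i f) = cre i (yop \<alpha> j f) - (if i < j then cre i f + cre i f else 0)"
  by (simp add: yop_def num_below_cre cre_diff cre_add cre_scale two_times_fun)

lemma ann_yop:
  "f \<in> alternating \<Longrightarrow> ann i (yop \<alpha> j f) = yop \<alpha> j (ann i f) - (if i < j then ann i f + ann i f else 0)"
  by (simp add: yop_def ann_num_below ann_diff ann_add ann_scale two_times_fun)
    (simp add: fun_eq_iff cscale_apply)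

lemma yop_comm:
  assumes "f \<in> alternating"
  shows "yop \<alpha> i (yop \<alpha> j f) = yop \<alpha> j (yop \<alpha> i f)"
  by (simp add: yop_def num_below_diff num_below_scale num_below_comm[OF assms, of i j] two_times_fun)
    (simp add: fun_eq_iff cscale_apply algebra_simps)

lemma yop_Suc: "0 < j \<Longrightarrow> yop \<alpha> (Suc j) f = yop \<alpha> j f + f - (cre j (ann j f) + cre j (ann j f))"
  by (simp add: yop_def num_below_Suc fun_eq_iff cscale_apply algebra_simps)

text \<open>\<open>cre i\<close> lowers the eigenvalue of \<open>yop \<alpha> j\<close> by 2 if
  \<open>i < j\<close>, and \<open>ann x\<close> raises it by 2 if \<open>x < j\<close>. For
  \<open>x\<close> among \<open>i - 1\<close>, \<open>i\<close>, \<open>i + 1\<close> the two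
  conditions coincide once \<open>j\<close> is neither \<open>i\<close> nor \<open>i + 1\<close>, so
  the shifts cancel.\<close>

lemma yop_far:
  assumes f: "f \<in> alternating" and "0 < i" "0 < j" "j \<noteq> i" "j \<noteq> i + 1"
  shows "eop i (yop \<alpha> j f) = yop \<alpha> j (eop i f)" "sop i (yop \<alpha> j f) = yop \<alpha> j (sop i f)"
proof -
  have neq: "i - 1 < j \<longleftrightarrow> i < j" "i + 1 < j \<longleftrightarrow> i < j"
    using assms by auto
  show "eop i (yop \<alpha> j f) = yop \<alpha> j (eop i f)" "sop i (yop \<alpha> j f) = yop \<alpha> j (sop i f)"
    using \<open>0 < i\<close>
    by (simp_all only: eop_def sop_def ann_yop[OF f] yop_cre cre_add cre_diff yop_add yop_diff neq split: if_splits)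
      (simp_all add: cre_0 algebra_simps)
qed

text \<open>\<open>yop_Suc\<close> eliminates \<open>yop \<alpha> (i + 1)\<close>. Moving
  \<open>yop \<alpha> i\<close> past the remaining operators, only \<open>ann (i - 1)\<close>
  produces a shift; the rest is normal ordering.\<close>

lemma yop_rels:
  assumes f: "f \<in> alternating" and i: "0 < i"
  shows "sop i (yop \<alpha> i f) - yop \<alpha> (i + 1) (sop i f) = - eop i f - f"
    and "yop \<alpha> i (sop i f) - sop i (yop \<alpha> (i + 1) f) = eop i f - f"
    and "eop i (yop \<alpha> i f - yop \<alpha> (i + 1) f) = - eop i f"
    and "yop \<alpha> i (eop i f) - yop \<alpha> (i + 1) (eop i f) = eop i f"
proof -
  have lt: "i - 1 < i" "0 < i" "i < i + 1"
    using i by auto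
  note facts = f lt
  show "sop i (yop \<alpha> i f) - yop \<alpha> (i + 1) (sop i f) = - eop i f - f"
    and "yop \<alpha> i (sop i f) - sop i (yop \<alpha> (i + 1) f) = eop i f - f"
    and "eop i (yop \<alpha> i f - yop \<alpha> (i + 1) f) = - eop i f"
    and "yop \<alpha> i (eop i f) - yop \<alpha> (i + 1) (eop i f) = eop i f"
    unfolding sop_def eop_def yop_Suc[OF i, folded Suc_eq_plus1] Suc_eq_plus1[symmetric]
    using i f
    by (simp_all add: yop_Suc ann_yop yop_cre yop_add yop_diff car_simps cre_scale ann_scale yop_scale two_times_fun)
qed

section \<open>Exterior powers as spans of iterated wedges\<close>

lemma ext_power_eq: "ext_power k V = cfun.span {wedges vs |vs. length vs = k \<and> set vs \<subseteq> V}"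
  by (simp add: ext_power_def wedge_eq_wedges)

lemma subspace_ext_power: "cfun.subspace (ext_power k V)"
  by (simp add: ext_power_def)

lemma wedges_in_ext_power: "length vs = k \<Longrightarrow> set vs \<subseteq> V \<Longrightarrow> wedges vs \<in> ext_power k V"
  unfolding ext_power_eq by (rule cfun.span_base) blast

text \<open>Induction principle reducing linear statements about an exterior power to pure
  wedges.\<close>

lemma ext_power_minimal:
  assumes "f \<in> ext_power k V" "cfun.subspace S"
    and "\<And>vs. length vs = k \<Longrightarrow> set vs \<subseteq> V \<Longrightarrow> wedges vs \<in> S"
  shows "f \<in> S"
proof -
  have "ext_power k V \<subseteq> S"
    unfolding ext_power_eq by (rule cfun.span_minimal) (use assms(2,3) in auto)
  then show ?thesis
    using assms(1) by blast
qed

lemma subspace_preimage: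
  assumes "cfun.subspace S" "A 0 = 0" "\<And>f g. A (f + g) = A f + A g"
    "\<And>c f. A (cscale c f) = cscale c (A f)"
  shows "cfun.subspace {f. A f \<in> S}"
  using assms by (intro cfun.subspaceI) (auto simp: cfun.subspace_0 cfun.subspace_add cfun.subspace_scale)

lemma subspace_kernel:
  assumes "A 0 = 0" "\<And>f g. A (f + g) = A f + A g" "\<And>c f. A (cscale c f) = cscale c (A f)"
  shows "cfun.subspace {f. A f = 0}"
  using assms by (intro cfun.subspaceI) auto

lemma lwedge_ext_power:
  assumes "f \<in> ext_power k V" "v \<in> V"
  shows "lwedge v f \<in> ext_power (Suc k) V"
proof -
  have "f \<in> {f. lwedge v f \<in> ext_power (Suc k) V}"
    using assms(1)
  proof (rule ext_power_minimal)
    show "cfun.subspace {f. lwedge v f \<in> ext_power (Suc k) V}"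
      by (rule subspace_preimage[OF subspace_ext_power]) (simp_all add: lwedge_0 lwedge_add lwedge_scale)
    show "wedges vs \<in> {f. lwedge v f \<in> ext_power (Suc k) V}" if "length vs = k" "set vs \<subseteq> V" for vs
      using wedges_in_ext_power[of "v # vs" "Suc k" V] assms(2) that by simp
  qed
  then show ?thesis
    by simp
qed

lemma contr_ext_power_0:
  assumes "f \<in> ext_power 0 V"
  shows "contr x f = 0"
proof -
  have "f \<in> {f. contr x f = 0}"
    using assms
    by (rule ext_power_minimal) (auto intro!: subspace_kernel simp: contr_vac contr_0 contr_add contr_scale)
  then show ?thesis
    by simp
qed

lemma subspace_contr: "cfun.subspace {f. contr x f \<in> ext_power k V}"
  by (rule subspace_preimage[OF subspace_ext_power]) (simp_all add: contr_0 contr_add contr_scale)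

text \<open>\<open>contr_lwedge\<close> splits a wedge \<open>v # us\<close> into a multiple of
  \<open>wedges us\<close> and the product of \<open>v\<close> with a contraction in one degree
  less, where the induction hypothesis applies. In degree one only multiples of \<open>vac\<close>
  occur.\<close>

lemma contr_ext_power: "f \<in> ext_power (Suc k) V \<Longrightarrow> contr x f \<in> ext_power k V"
proof (induction k arbitrary: f)
  case 0
  then have "f \<in> {f. contr x f \<in> ext_power 0 V}"
  proof (rule ext_power_minimal[OF _ subspace_contr])
    fix vs :: "('a \<Rightarrow> complex) list" assume "length vs = Suc 0"
    then obtain v where "vs = [v]"
      by (cases vs) auto
    then show "wedges vs \<in> {f. contr x f \<in> ext_power 0 V}"
      using cfun.subspace_scale[OF subspace_ext_power wedges_in_ext_power[of "[]" 0 V]]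
      by (simp add: contr_lwedge contr_vac lwedge_0)
  qed
  then show ?case
    by simp
next
  case (Suc k)
  from Suc.prems have "f \<in> {f. contr x f \<in> ext_power (Suc k) V}"
  proof (rule ext_power_minimal[OF _ subspace_contr])
    fix vs :: "('a \<Rightarrow> complex) list" assume "length vs = Suc (Suc k)" "set vs \<subseteq> V"
    then obtain v us where vs: "vs = v # us" "length us = Suc k" "v \<in> V" "set us \<subseteq> V"
      by (cases vs) auto
    then have "wedges us \<in> ext_power (Suc k) V"
      by (intro wedges_in_ext_power)
    then show "wedges vs \<in> {f. contr x f \<in> ext_power (Suc k) V}"
      using Suc.IH[of "wedges us"] vs
      by (auto simp: contr_lwedge intro!: cfun.subspace_diff cfun.subspace_scale subspace_ext_power
          lwedge_ext_power)
  qed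
  then show ?case
    by simp
qed

lemma lwedge_contr_ext_power:
  assumes "f \<in> ext_power k V" "v \<in> V"
  shows "lwedge v (contr x f) \<in> ext_power k V"
proof (cases k)
  case 0
  then show ?thesis
    using assms by (simp add: contr_ext_power_0 lwedge_0 cfun.subspace_0 subspace_ext_power)
next
  case (Suc l)
  then show ?thesis
    using assms by (simp add: lwedge_ext_power contr_ext_power)
qed

text \<open>Multilinearity of the wedge. It is applied to two spanning sets of the standard
  representation: the roots through coordinate 1 and the simple roots.\<close>

lemma ext_power_span:
  fixes B :: "('x \<Rightarrow> complex) set"
  shows "ext_power k (cfun.span B) = cfun.span {wedges vs |vs. length vs = k \<and> set vs \<subseteq> B}"
proof
  define S where "S k = {wedges vs |vs. length vs = k \<and> set vs \<subseteq> B}" for k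
  have SI: "wedges vs \<in> S (length vs)" if "set vs \<subseteq> B" for vs
    using that unfolding S_def by (intro CollectI exI[of _ vs] conjI refl)
  have S_cases: "\<exists>vs. f = wedges vs \<and> length vs = k \<and> set vs \<subseteq> B" if "f \<in> S k" for f k
    using that unfolding S_def by (rule CollectD)
  show "cfun.span {wedges vs |vs. length vs = k \<and> set vs \<subseteq> B} \<subseteq> ext_power k (cfun.span B)"
    unfolding ext_power_eq
    by (intro cfun.span_mono Collect_mono impI, elim exE conjE, intro exI conjI)
      (assumption, assumption, erule subset_trans[OF _ cfun.span_superset])
  \<comment> \<open>Linearity in the right factor, with the left one fixed in
    \<open>B\<close>.\<close>
  have base: "lwedge b f \<in> cfun.span (S (Suc k))" if b: "b \<in> B" and f: "f \<in> cfun.span (S k)" for b f k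
  proof -
    have "f \<in> {f. lwedge b f \<in> cfun.span (S (Suc k))}" if fS: "f \<in> S k" for f
    proof -
      obtain vs where "f = wedges vs" "length vs = k" "set vs \<subseteq> B"
        using S_cases[OF fS] by (elim exE conjE)
      then show ?thesis
        using cfun.span_base[OF SI[of "b # vs"]] b by simp
    qed
    then have "cfun.span (S k) \<subseteq> {f. lwedge b f \<in> cfun.span (S (Suc k))}"
      by (intro cfun.span_minimal subsetI subspace_preimage cfun.subspace_span lwedge_0 lwedge_add lwedge_scale)
    from subsetD[OF this f] show ?thesis
      by (rule CollectD)
  qed
  \<comment> \<open>Linearity in the left factor extends this from \<open>B\<close> to its
    span.\<close>
  have step: "lwedge v f \<in> cfun.span (S (Suc k))" if v: "v \<in> cfun.span B" and f: "f \<in> cfun.span (S k)" for v f k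
  proof -
    have "v \<in> {v. lwedge v f \<in> cfun.span (S (Suc k))}" if "v \<in> B" for v
      using base[OF that f] by (simp only: mem_Collect_eq)
    then have "cfun.span B \<subseteq> {v. lwedge v f \<in> cfun.span (S (Suc k))}"
      by (intro cfun.span_minimal subsetI subspace_preimage cfun.subspace_span lwedge_0_left lwedge_add_left
          lwedge_scale_left)
    from subsetD[OF this v] show ?thesis
      by (rule CollectD)
  qed
  have "wedges vs \<in> cfun.span (S (length vs))" if "set vs \<subseteq> cfun.span B" for vs
    using that
  proof (induction vs)
    case Nil
    show ?case
      using cfun.span_base[OF SI[of "[]"]] by simp
  next
    case (Cons v vs)
    then have "lwedge v (wedges vs) \<in> cfun.span (S (Suc (length vs)))"
      by (intro step) simp_all
    then show ?case
      by simp
  qed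
  then have wedges: "wedges vs \<in> cfun.span (S k)" if "length vs = k" "set vs \<subseteq> cfun.span B" for vs
    using that(2) unfolding that(1)[symmetric] .
  show "ext_power k (cfun.span B) \<subseteq> cfun.span {wedges vs |vs. length vs = k \<and> set vs \<subseteq> B}"
  proof
    fix f assume "f \<in> ext_power k (cfun.span B)"
    then have "f \<in> cfun.span (S k)"
      by (rule ext_power_minimal[OF _ cfun.subspace_span wedges])
    then show "f \<in> cfun.span {wedges vs |vs. length vs = k \<and> set vs \<subseteq> B}"
      by (simp only: S_def)
  qed
qed

lemma ext_power_alternating: "f \<in> ext_power k V \<Longrightarrow> f \<in> alternating"
  by (erule ext_power_minimal[OF _ subspace_alternating]) (rule alternating_wedges)

section \<open>Transpositions act as reflections\<close>

lemma lwedge_map: "lwedge a f (map q xs) = lwedge (a \<circ> q) (f \<circ> map q) xs"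
  by (induction xs arbitrary: f) (simp_all add: comp_def)

lemma perm_tensor_lwedge: "perm_tensor p (lwedge a f) = lwedge (perm_vec p a) (perm_tensor p f)"
  by (simp add: perm_tensor_def perm_vec_def lwedge_map fun_eq_iff comp_def)

lemma perm_tensor_vac: "perm_tensor p vac = vac"
  by (simp add: perm_tensor_def vac_def fun_eq_iff)

lemma perm_tensor_0: "perm_tensor p 0 = 0"
  and perm_tensor_add: "perm_tensor p (f + g) = perm_tensor p f + perm_tensor p g"
  and perm_tensor_scale: "perm_tensor p (cscale c f) = cscale c (perm_tensor p f)"
  by (simp_all add: perm_tensor_def cscale_def fun_eq_iff)

lemma perm_tensor_comp: "bij p \<Longrightarrow> bij q \<Longrightarrow> perm_tensor (p \<circ> q) f = perm_tensor p (perm_tensor q f)"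
  by (simp add: perm_tensor_def o_inv_distrib comp_assoc)

lemma perm_vec_transpose:
  "perm_vec (Transposition.transpose x y) v = v - cscale (v x - v y) (eps x - eps y)"
  by (auto simp: perm_vec_def eps_def cscale_apply fun_eq_iff Transposition.transpose_def)

text \<open>Derivation extending the rank one endomorphism of vectors that sends \<open>v\<close> to
  \<open>v x - v y\<close> times the root \<open>eps x - eps y\<close>.\<close>

definition reflect :: "'x \<Rightarrow> 'x \<Rightarrow> ('x list \<Rightarrow> complex) \<Rightarrow> 'x list \<Rightarrow> complex" where
  "reflect x y f = lwedge (eps x - eps y) (contr x f - contr y f)"

lemma reflect_0: "reflect x y 0 = 0"
  and reflect_add: "reflect x y (f + g) = reflect x y f + reflect x y g"
  and reflect_scale: "reflect x y (cscale c f) = cscale c (reflect x y f)"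
  by (simp_all add: reflect_def contr_0 contr_add contr_scale lwedge_0 lwedge_add lwedge_scale lwedge_diff
      fun_eq_iff cscale_apply algebra_simps)

text \<open>On vectors the transposition is the identity minus a rank one map with image spanned by
  the root. On a product, terms in which two factors are replaced contain the root twice and vanish,
  so only the derivation is left.\<close>

lemma perm_tensor_transpose_wedges:
  "perm_tensor (Transposition.transpose x y) (wedges vs) = wedges vs - reflect x y (wedges vs)"
proof (induction vs)
  case Nil
  show ?case
    by (simp add: perm_tensor_vac reflect_def contr_vac lwedge_0)
next
  case (Cons v vs)
  let ?b = "eps x - eps y"
  let ?f = "wedges vs"
  have sub: "lwedge (a - cscale c b) g = lwedge a g - cscale c (lwedge b g)" for a b :: "'a \<Rightarrow> complex" and c g
    using lwedge_add_left[of "a - cscale c b" "cscale c b" g]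
    by (simp add: lwedge_scale_left eq_diff_eq)
  have "perm_tensor (Transposition.transpose x y) (lwedge v ?f) =
      lwedge (v - cscale (v x - v y) ?b) (?f - reflect x y ?f)"
    using Cons.IH by (simp add: perm_tensor_lwedge perm_vec_transpose fun_diff_def)
  also have "\<dots> = lwedge v ?f - lwedge v (reflect x y ?f) - cscale (v x - v y) (lwedge ?b ?f)"
    by (simp add: sub lwedge_diff[of _ ?f] reflect_def lwedge_lwedge)
  also have "\<dots> = lwedge v ?f - reflect x y (lwedge v ?f)"
  proof -
    have "reflect x y (lwedge v ?f) =
        lwedge ?b (cscale (v x - v y) ?f - lwedge v (contr x ?f - contr y ?f))"
      unfolding reflect_def
      by (rule arg_cong[of _ _ "lwedge ?b"]) (simp add: contr_lwedge lwedge_diff[of v] cfun.scale_left_diff_distrib)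
    then show ?thesis
      unfolding lwedge_diff[of ?b "cscale _ _"] lwedge_scale lwedge_anticomm[of ?b v]
      by (simp add: reflect_def)
  qed
  finally show ?case
    by simp
qed

lemma perm_tensor_transpose:
  assumes "f \<in> ext_power k V"
  shows "perm_tensor (Transposition.transpose x y) f = f - reflect x y f"
proof -
  let ?A = "\<lambda>f. perm_tensor (Transposition.transpose x y) f - (f - reflect x y f)"
  have "f \<in> {f. ?A f = 0}"
    using assms
  proof (rule ext_power_minimal)
    show "cfun.subspace {f. ?A f = 0}"
      by (rule subspace_kernel)
        (simp_all add: perm_tensor_0 perm_tensor_add perm_tensor_scale reflect_0 reflect_add reflect_scale
          cfun.scale_right_diff_distrib)
  qed (simp add: perm_tensor_transpose_wedges)
  then show ?thesis
    by simp
qed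

text \<open>In the second difference of the \<open>ann\<close> operators, neighbouring partial sums
  differ by a single contraction, leaving \<open>contr i f - contr (i + 1) f\<close>.\<close>

lemma sop_eq_reflect:
  assumes "0 < i"
  shows "sop i f = f - reflect i (i + 1) f"
proof -
  obtain m where "i = Suc m"
    using assms by (cases i) auto
  then have "ann (i + 1) f = ann i f + contr (i + 1) f" "ann i f = ann (i - 1) f + contr i f"
    by (simp_all add: ann_def)
  then show ?thesis
    by (simp add: sop_def reflect_def cre_def)
qed

section \<open>The standard representation\<close>

lemma sum_fun_apply: "(\<Sum>a\<in>A. f a) x = (\<Sum>a\<in>A. f a x)"
  by (induction A rule: infinite_finite_induct) simp_all

lemma subspace_std_rep: "cfun.subspace (std_rep n)"
  by (rule cfun.subspaceI)
    (auto simp: std_rep_def cscale_def sum.distrib simp flip: sum_distrib_left)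

lemma eps_diff_std_rep: "x \<in> {1..n} \<Longrightarrow> y \<in> {1..n} \<Longrightarrow> eps x - eps y \<in> std_rep n"
  by (auto simp: std_rep_def eps_def sum_subtractf)

text \<open>The coefficients \<open>- v x\<close> recover the coordinates from 2 on; coordinate 1 is
  then forced by the vanishing sum.\<close>

lemma std_rep_span_star: "std_rep n = cfun.span {eps 1 - eps x |x. x \<in> {2..n}}"
proof
  show "cfun.span {eps 1 - eps x |x. x \<in> {2..n}} \<subseteq> std_rep n"
    by (rule cfun.span_minimal) (auto intro!: eps_diff_std_rep subspace_std_rep)
  show "std_rep n \<subseteq> cfun.span {eps 1 - eps x |x. x \<in> {2..n}}"
  proof
    fix v assume v: "v \<in> std_rep n"
    have "v = (\<Sum>x=2..n. cscale (- v x) (eps 1 - eps x))"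
    proof
      fix y
      have out: "v y = 0" if "y \<notin> {1..n}"
        using v that by (simp add: std_rep_def)
      have "n \<ge> 1 \<Longrightarrow> v 1 = - (\<Sum>x=2..n. v x)"
        using v sum.atLeast_Suc_atMost[of 1 n v] by (simp add: std_rep_def numeral_2_eq_2 eq_neg_iff_add_eq_0)
      moreover have "(\<Sum>x=2..n. cscale (- v x) (eps 1 - eps x)) y =
          (\<Sum>x=2..n. (if y = 1 then - v x else 0) + (if x = y then v x else 0))"
        unfolding sum_fun_apply
        by (intro sum.cong refl) (auto simp: cscale_apply eps_def)
      ultimately show "v y = (\<Sum>x=2..n. cscale (- v x) (eps 1 - eps x)) y"
        using out by (cases "y = 1"; cases "n = 0") (simp_all add: sum.distrib sum_negf sum.delta)
    qed
    moreover have "eps 1 - eps x \<in> {eps 1 - eps x |x. x \<in> {2..n}}" if "x \<in> {2..n}" for x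
      using that by blast
    then have "(\<Sum>x=2..n. cscale (- v x) (eps 1 - eps x)) \<in> cfun.span {eps 1 - eps x |x. x \<in> {2..n}}"
      by (intro cfun.span_sum cfun.span_scale cfun.span_base)
    ultimately show "v \<in> cfun.span {eps 1 - eps x |x. x \<in> {2..n}}"
      by simp
  qed
qed

lemma std_rep_span_simple: "std_rep n = cfun.span {eps i - eps (i + 1) |i. i \<in> {1..<n}}"
    (is "_ = cfun.span ?S")
proof
  show "cfun.span ?S \<subseteq> std_rep n"
    by (rule cfun.span_minimal) (auto intro!: eps_diff_std_rep subspace_std_rep)
  have "eps 1 - eps x \<in> cfun.span ?S" if "1 \<le> x" "x \<le> n" for x
  proof -
    have "eps 1 - eps x = (\<Sum>i=1..<x. eps i - eps (i + 1))"
    proof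
      show "(eps 1 - eps x) y = (\<Sum>i=1..<x. eps i - eps (i + 1)) y" for y
        using sum_Suc_diff'[of 1 x "\<lambda>i. - eps i y"] that by (simp add: sum_fun_apply)
    qed
    then show ?thesis
      using that by (simp only:) (rule cfun.span_sum, rule cfun.span_base, auto)
  qed
  then show "std_rep n \<subseteq> cfun.span ?S"
    unfolding std_rep_span_star by (intro cfun.span_minimal) auto
qed

text \<open>The full coordinate sum vanishes on each factor. This linear relation among the
  contractions isolates \<open>contr 1\<close> in the irreducibility proof.\<close>

lemma ann_ext_power_std_rep:
  assumes "f \<in> ext_power k (std_rep n)"
  shows "ann n f = 0"
proof -
  have wedges: "ann n (wedges vs) = 0" if "set vs \<subseteq> std_rep n" for vs
    using that
  proof (induction vs)
    case Nil
    show ?case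
      by (simp add: ann_def contr_vac)
  next
    case (Cons v vs)
    have "(\<Sum>x=1..n. v x) = 0"
      using Cons.prems by (simp add: std_rep_def)
    moreover have "ann n (wedges vs) = 0"
      using Cons.IH Cons.prems by (simp only: zero_fun_def list.set insert_subset)
    moreover have "ann n (lwedge v (wedges vs)) =
        cscale (\<Sum>x=1..n. v x) (wedges vs) - lwedge v (ann n (wedges vs))"
      by (simp add: ann_def contr_lwedge sum_subtractf lwedge_sum cfun.scale_sum_left)
    ultimately show ?case
      by (simp add: lwedge_0)
  qed
  have "f \<in> {f. ann n f = 0}"
    using assms
    by (rule ext_power_minimal) (intro CollectI wedges subspace_kernel ann_0 ann_add ann_scale; assumption)+
  then show ?thesis
    by simp
qed

section \<open>Irreducibility\<close>

text \<open>The action of \<open>(\<epsilon>\<^sub>a - \<epsilon>\<^sub>x) \<otimes> (\<epsilon>\<^sub>a - \<epsilon>\<^sub>y)\<^sup>* \<in> gl(V)\<close> by derivations on the exterior algebra.\<close>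

definition tensor_root :: "'x \<Rightarrow> 'x \<Rightarrow> 'x \<Rightarrow> ('x list \<Rightarrow> complex) \<Rightarrow> 'x list \<Rightarrow> complex" where
  "tensor_root a x y f = lwedge (eps a - eps x) (contr a f - contr y f)"

lemma tensor_root_linear:
  "tensor_root a x y (f + g) = tensor_root a x y f + tensor_root a x y g"
  "tensor_root a x y (f - g) = tensor_root a x y f - tensor_root a x y g"
  "tensor_root a x y (cscale c f) = cscale c (tensor_root a x y f)"
  by (simp_all add: tensor_root_def contr_add contr_diff contr_scale lwedge_add lwedge_diff lwedge_scale
      cfun.scale_right_diff_distrib)

text \<open>The commutator rule for rank one endomorphisms. The scalars 2 and 1 are the values of
  the functional of \<open>eps a - eps y\<close> on \<open>eps a - eps z\<close>, and likewise for
  \<open>w\<close> and \<open>x\<close>.\<close>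

lemma tensor_root_commutator:
  assumes f: "f \<in> alternating" and ne: "a \<noteq> x" "a \<noteq> y" "a \<noteq> z" "a \<noteq> w"
  shows "tensor_root a x y (tensor_root a z w f) - tensor_root a z w (tensor_root a x y f) =
    cscale (if y = z then 2 else 1) (tensor_root a x w f) -
    cscale (if w = x then 2 else 1) (tensor_root a z y f)"
proof -
  have expand: "tensor_root a x y (tensor_root a z w f) =
      cscale (if y = z then 2 else 1) (tensor_root a x w f) -
      lwedge (eps a - eps x) (lwedge (eps a - eps z)
        ((contr a (contr a f) - contr a (contr w f)) - (contr y (contr a f) - contr y (contr w f))))"
    if "a \<noteq> y" "a \<noteq> z" for x y z w
  proof -
    have "contr a (lwedge (eps a - eps z) g) - contr y (lwedge (eps a - eps z) g) =
        cscale (if y = z then 2 else 1) g - lwedge (eps a - eps z) (contr a g - contr y g)" for g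
      using that by (auto simp: contr_lwedge lwedge_diff eps_def fun_eq_iff cscale_apply)
    then show ?thesis
      by (simp only: tensor_root_def lwedge_diff[of _ "cscale _ _"] lwedge_scale contr_diff)
  qed
  \<comment> \<open>The terms with two exterior factors and two contractions agree in both products:
    exchanging the factors and exchanging the contractions each gives a sign.\<close>
  have contr2: "contr a (contr a f) - contr a (contr w f) - (contr y (contr a f) - contr y (contr w f)) =
      - (contr a (contr a f) - contr a (contr y f) - (contr w (contr a f) - contr w (contr y f)))"
  proof -
    have "contr a (contr a f) = - contr a (contr a f)"
      by (rule contr_anticomm[OF f])
    then have "contr a (contr a f) = 0"
      by (simp add: fun_eq_iff)
    then show ?thesis
      using contr_anticomm[OF f, of y w] contr_anticomm[OF f, of a w] contr_anticomm[OF f, of y a] by simp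
  qed
  show ?thesis
    unfolding expand[OF ne(2,3), of x w] expand[OF ne(4,1), of z y] contr2
    by (simp only: lwedge_uminus lwedge_anticomm[of "eps a - eps z" "eps a - eps x"]) simp
qed

definition lwedges :: "'x \<Rightarrow> 'x list \<Rightarrow> ('x list \<Rightarrow> complex) \<Rightarrow> 'x list \<Rightarrow> complex" where
  "lwedges a zs f = foldr (\<lambda>z. lwedge (eps a - eps z)) zs f"

lemma lwedges_Cons: "lwedges a (z # zs) f = lwedge (eps a - eps z) (lwedges a zs f)"
  and lwedges_Nil: "lwedges a [] f = f"
  and lwedges_append: "lwedges a (ys @ zs) f = lwedges a ys (lwedges a zs f)"
  by (simp_all add: lwedges_def)

lemma lwedges_diff: "lwedges a zs (f - g) = lwedges a zs f - lwedges a zs g"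
  by (rule list.induct[of "\<lambda>zs. lwedges a zs (f - g) = lwedges a zs f - lwedges a zs g"])
    (simp_all add: lwedges_Nil lwedges_Cons lwedge_diff)

lemma lwedges_scale: "lwedges a zs (cscale c f) = cscale c (lwedges a zs f)"
  by (induction zs) (simp_all add: lwedges_Nil lwedges_Cons lwedge_scale)

lemma lwedges_vac: "lwedges a zs vac = wedges (map (\<lambda>z. eps a - eps z) zs)"
  by (simp add: lwedges_def foldr_map comp_def)

text \<open>
  Each exterior factor that the contraction passes is moved to \<open>ps\<close>; the correction terms are
  shorter products and lie in \<open>U\<close>.
\<close>

lemma contr_lwedges:
  assumes "cfun.subspace U"
    and "\<And>us. Suc (length us) = length ps + length zs \<Longrightarrow> set us \<subseteq> S \<Longrightarrow> lwedges a us h \<in> U"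
    and "set ps \<subseteq> S" "set zs \<subseteq> S"
  shows "lwedges a ps (contr y (lwedges a zs h)) -
    cscale ((- 1) ^ length zs) (lwedges a (ps @ zs) (contr y h)) \<in> U"
  using assms(2-)
proof (induction zs arbitrary: ps)
  case Nil
  have "lwedges a ps (contr y h) - lwedges a ps (contr y h) \<in> U"
    using cfun.subspace_0[OF assms(1)] by simp
  then show ?case
    by (simp add: lwedges_Nil zero_fun_def)
next
  case (Cons z zs)
  have A: "lwedges a (ps @ [z]) (contr y (lwedges a zs h)) -
      cscale ((- 1) ^ length zs) (lwedges a ((ps @ [z]) @ zs) (contr y h)) \<in> U"
    using Cons.IH[of "ps @ [z]"] Cons.prems by (simp add: fun_diff_def)
  have B: "lwedges a (ps @ zs) h \<in> U"
    using Cons.prems by (intro Cons.prems(1)) auto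
  have "cscale ((eps a - eps z) y) (lwedges a (ps @ zs) h) -
      (lwedges a (ps @ [z]) (contr y (lwedges a zs h)) -
      cscale ((- 1) ^ length zs) (lwedges a ((ps @ [z]) @ zs) (contr y h))) \<in> U"
    by (rule cfun.subspace_diff[OF assms(1) cfun.subspace_scale[OF assms(1) B] A])
  also have "cscale ((eps a - eps z) y) (lwedges a (ps @ zs) h) -
      (lwedges a (ps @ [z]) (contr y (lwedges a zs h)) -
      cscale ((- 1) ^ length zs) (lwedges a ((ps @ [z]) @ zs) (contr y h))) =
    lwedges a ps (contr y (lwedges a (z # zs) h)) -
    cscale ((- 1) ^ length (z # zs)) (lwedges a (ps @ z # zs) (contr y h))"
    by (simp add: lwedges_append lwedges_Cons lwedges_Nil contr_lwedge lwedges_diff lwedges_scale)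
  finally show ?case
    by (simp add: fun_diff_def)
qed

text \<open>Each vector vanishes outside \<open>{1..n}\<close>, so a bad letter puts a zero into
  every product defining \<open>wedge\<close>. Thus the letters at a nonzero coefficient are
  admissible contraction indices.\<close>

lemma ext_power_support:
  assumes "f \<in> ext_power k (std_rep n)" "f xs \<noteq> 0"
  shows "length xs = k" "set xs \<subseteq> {1..n}"
proof -
  have "f \<in> {f. f xs \<noteq> 0 \<longrightarrow> length xs = k \<and> set xs \<subseteq> {1..n}}"
    using assms(1)
  proof (rule ext_power_minimal)
    show "cfun.subspace {f. f xs \<noteq> 0 \<longrightarrow> length xs = k \<and> set xs \<subseteq> {1..n}}"
      by (rule cfun.subspaceI) (auto simp: cscale_apply)
    fix vs :: "(nat \<Rightarrow> complex) list"
    assume len: "length vs = k" and vs: "set vs \<subseteq> std_rep n"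
    have "wedge vs xs = 0" if len': "length xs = length vs" and xs: "\<not> set xs \<subseteq> {1..n}"
    proof -
      obtain a where a: "a < length xs" "xs ! a \<notin> {1..n}"
        using xs by (auto simp: subset_iff in_set_conv_nth)
      have "(\<Prod>b<length vs. (vs ! \<sigma> b) (xs ! b)) = 0" if "\<sigma> permutes {..<length vs}" for \<sigma>
      proof -
        have "\<sigma> a < length vs"
          using permutes_in_image[OF that, of a] a len' by simp
        then have "vs ! \<sigma> a \<in> std_rep n"
          using vs nth_mem by blast
        then have "(vs ! \<sigma> a) (xs ! a) = 0"
          using a(2) by (simp add: std_rep_def)
        then show ?thesis
          using a(1) len' by (intro prod_zero bexI[of _ a]) simp_all
      qed
      then show ?thesis
        by (simp add: wedge_def del: prod_zero_iff)
    qed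
    moreover have "wedge vs xs = 0" if "length xs \<noteq> length vs"
      using that by (simp add: wedge_def)
    ultimately show "wedges vs \<in> {f. f xs \<noteq> 0 \<longrightarrow> length xs = k \<and> set xs \<subseteq> {1..n}}"
      using len unfolding wedge_eq_wedges[symmetric] by auto
  qed
  then show "length xs = k" "set xs \<subseteq> {1..n}"
    using assms(2) by auto
qed

lemma foldr_contr: "foldr contr ys f xs = f (rev ys @ xs)"
  by (induction ys arbitrary: xs) (simp_all add: contr_def)

lemma ext_power_std_rep_irreducible:
  assumes U: "cfun.subspace U" "U \<subseteq> ext_power k (std_rep n)" "U \<noteq> {0}"
    and stable: "\<And>x f. x \<in> {2..n} \<Longrightarrow> f \<in> U \<Longrightarrow> perm_tensor (Transposition.transpose 1 x) f \<in> U"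
  shows "U = ext_power k (std_rep n)"
proof
  let ?M = "tensor_root (1::nat)"
  have alt: "f \<in> alternating" if "f \<in> U" for f
    using ext_power_alternating subsetD[OF U(2) that] .
  have diag: "?M x x f \<in> U" if x: "x \<in> {2..n}" and f: "f \<in> U" for x f
  proof -
    have "f - perm_tensor (Transposition.transpose 1 x) f = ?M x x f"
      using perm_tensor_transpose[OF subsetD[OF U(2) f], of 1 x] by (simp add: tensor_root_def reflect_def)
    then show ?thesis
      using cfun.subspace_diff[OF U(1) f stable[OF x f]] by simp
  qed
  have M: "?M x y f \<in> U" if x: "x \<in> {2..n}" and y: "y \<in> {2..n}" and f: "f \<in> U" for x y f
  proof (cases "x = y")
    case True
    then show ?thesis
      using diag x f by simp
  next
    case False
    have ne: "1 \<noteq> x" "1 \<noteq> y"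
      using x y by auto
    \<comment> \<open>The commutator of two diagonal operators gives the antisymmetric part of
      \<open>?M x y\<close>.\<close>
    have K: "?M x y g - ?M y x g \<in> U" if g: "g \<in> U" for g
    proof -
      have "?M x x (?M y y g) - ?M y y (?M x x g) = ?M x y g - ?M y x g"
        using tensor_root_commutator[OF alt[OF g] ne(1,1,2,2)] False by simp
      moreover have "?M x x (?M y y g) - ?M y y (?M x x g) \<in> U"
        using x y g by (intro cfun.subspace_diff U(1) diag)
      ultimately show ?thesis
        by simp
    qed
    \<comment> \<open>Bracketing that difference with \<open>?M x x\<close> gives the symmetric
      part, \<open>2 (?M x y + ?M y x) - 2 ?M x x\<close>, so both parts together determine
      \<open>?M x y\<close>.\<close>
    let ?D = "?M x x (?M x y f - ?M y x f) - (?M x y (?M x x f) - ?M y x (?M x x f))"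
    have D: "?D \<in> U"
      using x f by (intro cfun.subspace_diff U(1) diag K)
    have e1: "?M x x (?M x y f) - ?M x y (?M x x f) = cscale 2 (?M x y f) - ?M x x f"
      using tensor_root_commutator[OF alt[OF f] ne(1,1,1,2)] False by simp
    have e2: "?M x x (?M y x f) - ?M y x (?M x x f) = ?M x x f - cscale 2 (?M y x f)"
      using tensor_root_commutator[OF alt[OF f] ne(1,1,2,1)] False by simp
    have "?D = (?M x x (?M x y f) - ?M x y (?M x x f)) - (?M x x (?M y x f) - ?M y x (?M x x f))"
      unfolding tensor_root_linear by (simp add: algebra_simps)
    also have "\<dots> = (cscale 2 (?M x y f) - ?M x x f) - (?M x x f - cscale 2 (?M y x f))"
      unfolding e1 e2 ..
    finally have "?D = (cscale 2 (?M x y f) - ?M x x f) - (?M x x f - cscale 2 (?M y x f))" .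
    then have "?M x y f = cscale (1/4) (?D + cscale 2 (?M x y f - ?M y x f) + cscale 2 (?M x x f))"
      by (simp add: fun_eq_iff cscale_apply)
    moreover have "cscale (1/4) (?D + cscale 2 (?M x y f - ?M y x f) + cscale 2 (?M x x f)) \<in> U"
      by (intro cfun.subspace_scale cfun.subspace_add U(1) D K[OF f] diag[OF x f])
    ultimately show ?thesis
      by simp
  qed
  have H1: "lwedge (eps 1 - eps x) (contr 1 f) \<in> U" if x: "x \<in> {2..n}" and f: "f \<in> U" for x f
  proof -
    have n: "1 \<le> n"
      using x by simp
    have "(\<Sum>y=1..n. contr y f) = 0"
      using ann_ext_power_std_rep[OF subsetD[OF U(2) f]] by (simp add: ann_def)
    then have sum: "(\<Sum>y=2..n. contr y f) = - contr 1 f"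
      using n by (simp add: sum.atLeast_Suc_atMost numeral_2_eq_2 add_eq_0_iff)
    \<comment> \<open>There are \<open>n - 1\<close> copies of \<open>contr 1 f\<close>, and the
      relation among contractions supplies one more.\<close>
    have "(\<Sum>y=2..n. contr 1 f - contr y f) = cscale (of_nat n) (contr 1 f)"
      unfolding sum_subtractf sum using n by (simp add: fun_eq_iff sum_fun_apply cscale_apply of_nat_diff algebra_simps)
    then have "cscale (of_nat n) (lwedge (eps 1 - eps x) (contr 1 f)) = (\<Sum>y=2..n. ?M x y f)"
      by (simp add: tensor_root_def lwedge_scale[symmetric] lwedge_sum[symmetric])
    then have "lwedge (eps 1 - eps x) (contr 1 f) = cscale (1 / of_nat n) (\<Sum>y=2..n. ?M x y f)"
      using n by (simp add: fun_eq_iff cscale_apply field_simps)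
    moreover have "cscale (1 / of_nat n) (\<Sum>y=2..n. ?M x y f) \<in> U"
      using x f by (intro cfun.subspace_scale cfun.subspace_sum U(1) M)
    ultimately show ?thesis
      by simp
  qed
  have H: "lwedge (eps 1 - eps x) (contr y f) \<in> U" if x: "x \<in> {2..n}" and y: "y \<in> {1..n}" and f: "f \<in> U" for x y f
  proof (cases "y = 1")
    case True
    then show ?thesis
      using H1 x f by simp
  next
    case False
    then have "lwedge (eps 1 - eps x) (contr 1 f) - ?M x y f \<in> U"
      using x y f by (intro cfun.subspace_diff U(1) H1 M) auto
    then show ?thesis
      by (simp add: tensor_root_def lwedge_diff)
  qed
  \<comment> \<open>Contract by all of \<open>ys\<close>, then multiply by as many roots. One
    further pair is applied through \<open>H\<close>, and \<open>contr_lwedges\<close> moves its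
    contraction inside; the correction terms are words for the shorter \<open>ys\<close>.\<close>
  have words: "lwedges 1 zs (foldr contr ys f) \<in> U"
    if "length zs = length ys" "set zs \<subseteq> {2..n}" "set ys \<subseteq> {1..n}" "f \<in> U" for zs ys f
    using that
  proof (induction ys arbitrary: zs)
    case Nil
    then show ?case
      by (simp add: lwedges_Nil)
  next
    case (Cons y ys)
    from Cons.prems(1) obtain z zs' where zs: "zs = z # zs'"
      by (cases zs) auto
    define h where "h = foldr contr ys f"
    define c :: complex where "c = (- 1) ^ length zs'"
    have IH: "lwedges 1 us h \<in> U" if "length us = length ys" "set us \<subseteq> {2..n}" for us
      using Cons that by (simp add: h_def)
    have "lwedge (eps 1 - eps z) (contr y (lwedges 1 zs' h)) \<in> U"
      using Cons.prems zs by (intro H IH) auto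
    moreover have "lwedges 1 [z] (contr y (lwedges 1 zs' h)) -
        cscale c (lwedges 1 ([z] @ zs') (contr y h)) \<in> U"
      unfolding c_def using Cons.prems zs by (intro contr_lwedges[OF U(1), of _ _ "{2..n}"] IH) auto
    ultimately have "lwedge (eps 1 - eps z) (contr y (lwedges 1 zs' h)) -
        (lwedges 1 [z] (contr y (lwedges 1 zs' h)) - cscale c (lwedges 1 ([z] @ zs') (contr y h))) \<in> U"
      by (rule cfun.subspace_diff[OF U(1)])
    then have "cscale c (lwedges 1 zs (contr y h)) \<in> U"
      by (simp add: lwedges_Cons lwedges_Nil zs)
    then have "cscale c (cscale c (lwedges 1 zs (contr y h))) \<in> U"
      by (rule cfun.subspace_scale[OF U(1)])
    \<comment> \<open>The sign \<open>c\<close> is removed by scaling with it a second time.\<close>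
    moreover have "c * c = 1"
      by (simp add: c_def flip: power_mult_distrib)
    ultimately show ?case
      by (simp add: h_def)
  qed
  have "\<exists>f\<in>U. f \<noteq> 0"
    using U(3) cfun.subspace_0[OF U(1)] by auto
  then obtain f where f: "f \<in> U" "f \<noteq> 0" ..
  from f(2) have "\<exists>xs. f xs \<noteq> 0"
    by (simp add: fun_eq_iff)
  then obtain xs where xs: "f xs \<noteq> 0" ..
  note fW = subsetD[OF U(2) f(1)]
  note supp = ext_power_support[OF fW]
  \<comment> \<open>Contracting by all letters of a nonzero coefficient leaves a nonzero scalar. The
    reversal compensates for the order in \<open>foldr_contr\<close>, and longer lists vanish by
    degree.\<close>
  have "foldr contr (rev xs) f = cscale (f xs) vac"
  proof
    fix ys
    have "f (xs @ ys) = 0" if "ys \<noteq> []"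
      using supp(1)[of "xs @ ys"] supp(1)[OF xs] that by auto
    then show "foldr contr (rev xs) f ys = cscale (f xs) vac ys"
      by (cases "ys = []") (simp_all add: foldr_contr cscale_apply vac_def)
  qed
  then have contr_f: "foldr contr (rev xs) f = cscale (f xs) vac" .
  have vac: "wedges (map (\<lambda>z. eps 1 - eps z) zs) \<in> U" if zs: "length zs = k" "set zs \<subseteq> {2..n}" for zs
  proof -
    have "lwedges 1 zs (foldr contr (rev xs) f) \<in> U"
      using supp[OF xs] zs by (intro words f(1)) simp_all
    then have "cscale (f xs) (lwedges 1 zs vac) \<in> U"
      unfolding contr_f lwedges_scale .
    then have "cscale (1 / f xs) (cscale (f xs) (lwedges 1 zs vac)) \<in> U"
      by (rule cfun.subspace_scale[OF U(1)])
    moreover have "cscale (1 / f xs) (cscale (f xs) g) = g" for g :: "nat list \<Rightarrow> complex"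
      using xs by simp
    ultimately show ?thesis
      unfolding lwedges_vac by (simp only:)
  qed
  have "wedges vs \<in> U"
    if len: "length vs = k" and vs: "set vs \<subseteq> {eps 1 - eps x |x. x \<in> {2..n}}" for vs
  proof -
    have "\<forall>v\<in>set vs. \<exists>z. v = eps 1 - eps z \<and> z \<in> {2..n}"
      using vs by (simp add: subset_iff)
    from bchoice[OF this] obtain g where g: "\<forall>v\<in>set vs. v = eps 1 - eps (g v) \<and> g v \<in> {2..n}"
      ..
    have g1: "eps 1 - eps (g v) = v" if "v \<in> set vs" for v
      by (rule sym, rule conjunct1, rule bspec[OF g that])
    have g2: "g v \<in> {2..n}" if "v \<in> set vs" for v
      by (rule conjunct2, rule bspec[OF g that])
    have "map ((\<lambda>z. eps 1 - eps z) \<circ> g) vs = vs"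
      by (rule map_idI) (simp only: comp_apply g1)
    then have "map (\<lambda>z. eps 1 - eps z) (map g vs) = vs"
      by (simp only: map_map)
    moreover have "set (map g vs) \<subseteq> {2..n}"
      unfolding set_map using g2 by (rule image_subsetI)
    moreover have "length (map g vs) = k"
      using len by simp
    ultimately show ?thesis
      using vac[of "map g vs"] by simp
  qed
  then have "{wedges vs |vs. length vs = k \<and> set vs \<subseteq> {eps 1 - eps x |x. x \<in> {2..n}}} \<subseteq> U"
    by (intro subsetI, elim CollectE exE conjE) (simp only:)
  then show "ext_power k (std_rep n) \<subseteq> U"
    unfolding std_rep_span_star ext_power_span using U(1) by (rule cfun.span_minimal)
qed (rule U(2))

text \<open>A spanning set of joint eigenvectors contains a basis. This permits using wedges over
  all index words, with their repetitions and sign duplicates.\<close>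

lemma simultaneously_diagonalI:
  assumes "cfun.span S = W" "\<And>f b. f \<in> F \<Longrightarrow> b \<in> S \<Longrightarrow> \<exists>c. f b = cscale c b"
  shows "simultaneously_diagonal F W"
proof -
  obtain B where B: "B \<subseteq> S" "cfun.independent B" "S \<subseteq> cfun.span B"
    using cfun.maximal_independent_subset[of S] .
  have "cfun.span B = W"
    using cfun.span_mono[OF B(1)] cfun.span_minimal[OF B(3) cfun.subspace_span] assms(1) by (intro equalityI) simp_all
  then show ?thesis
    unfolding simultaneously_diagonal_def
    by (intro exI[of _ B] conjI ballI B(2) assms(2)) (assumption | rule subsetD[OF B(1)])+
qed

section \<open>The weight basis\<close>

abbreviation states :: "nat list \<Rightarrow> nat list \<Rightarrow> complex" where
  "states is \<equiv> foldr cre is vac"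

lemma states_eq_wedges: "states is = wedges (map (\<lambda>i. eps i - eps (i + 1)) is)"
proof -
  have "cre = (\<lambda>i. lwedge (eps i - eps (i + 1)))"
    by (rule ext) (simp add: cre_def)
  then show ?thesis
    by (simp add: foldr_map comp_def)
qed

lemma states_in_ext_power:
  "length is = k \<Longrightarrow> set is \<subseteq> {1..<n} \<Longrightarrow> states is \<in> ext_power k (std_rep n)"
  unfolding states_eq_wedges by (intro wedges_in_ext_power) (auto intro!: eps_diff_std_rep)

lemma ext_power_span_states:
  "cfun.span {states is |is. length is = k \<and> set is \<subseteq> {1..<n}} = ext_power k (std_rep n)"
proof
  let ?S = "{states is |is. length is = k \<and> set is \<subseteq> {1..<n}}"
  show "cfun.span ?S \<subseteq> ext_power k (std_rep n)"
    by (intro cfun.span_minimal subspace_ext_power subsetI, elim CollectE exE conjE)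
      (simp only: states_in_ext_power)
  have "wedges vs \<in> cfun.span ?S"
    if len: "length vs = k" and vs: "set vs \<subseteq> {eps i - eps (i + 1) |i. i \<in> {1..<n}}" for vs
  proof -
    have "\<forall>v\<in>set vs. \<exists>i. v = eps i - eps (i + 1) \<and> i \<in> {1..<n}"
      using vs by (simp add: subset_iff)
    from bchoice[OF this] obtain g where g: "\<forall>v\<in>set vs. v = eps (g v) - eps (g v + 1) \<and> g v \<in> {1..<n}" ..
    have g1: "eps (g v) - eps (g v + 1) = v" if "v \<in> set vs" for v
      by (rule sym, rule conjunct1, rule bspec[OF g that])
    have g2: "g v \<in> {1..<n}" if "v \<in> set vs" for v
      by (rule conjunct2, rule bspec[OF g that])
    have "map ((\<lambda>i. eps i - eps (i + 1)) \<circ> g) vs = vs"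
      by (rule map_idI) (simp only: comp_apply g1)
    then have "wedges vs = states (map g vs)"
      unfolding states_eq_wedges by (simp only: map_map)
    moreover have "set (map g vs) \<subseteq> {1..<n}"
      unfolding set_map using g2 by (rule image_subsetI)
    moreover have "length (map g vs) = k"
      using len by simp
    ultimately have "wedges vs \<in> ?S"
      by (intro CollectI exI[of _ "map g vs"] conjI)
    then show ?thesis
      by (rule cfun.span_base)
  qed
  then have "{wedges vs |vs. length vs = k \<and> set vs \<subseteq> {eps i - eps (i + 1) |i. i \<in> {1..<n}}} \<subseteq> cfun.span ?S"
    by (intro subsetI, elim CollectE exE conjE) (simp only:)
  then show "ext_power k (std_rep n) \<subseteq> cfun.span ?S"
    unfolding std_rep_span_simple ext_power_span by (rule cfun.span_minimal[OF _ cfun.subspace_span])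
qed

text \<open>The eigenvalue is \<open>\<alpha> + j - 1\<close> on \<open>vac\<close>, and each factor
  of index below \<open>j\<close> lowers it by 2.\<close>

lemma yop_states:
  assumes "set is \<subseteq> {1..<n}"
  shows "\<exists>c. yop \<alpha> j (states is) = cscale c (states is)"
  using assms
proof (induction "is")
  case Nil
  have "num_below j vac = 0"
    by (simp add: num_below_def ann_def contr_vac cre_0)
  then show ?case
    by (auto simp: yop_def)
next
  case (Cons i "is")
  then obtain c where c: "yop \<alpha> j (states is) = cscale c (states is)"
    by auto
  have "yop \<alpha> j (cre i (states is)) = cscale (c - (if i < j then 2 else 0)) (cre i (states is))"
    using Cons.prems by (simp add: yop_cre c cre_scale two_times_fun cfun.scale_left_diff_distrib)
  then show ?case
    by auto
qed

section \<open>Nonvanishing of \<open>e_1\<close>\<close>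

lemma ann_states:
  assumes "0 \<notin> set is" "i \<notin> set is"
  shows "ann i (states is) = 0"
proof -
  have "0 \<notin> set is \<longrightarrow> i \<notin> set is \<longrightarrow> ann i (states is) = 0"
    by (rule list.induct[of "\<lambda>is. 0 \<notin> set is \<longrightarrow> i \<notin> set is \<longrightarrow> ann i (states is) = 0"])
      (auto simp: ann_cre cre_0 ann_def[of i vac] contr_vac)
  then show ?thesis
    using assms by simp
qed

lemma contr_states:
  assumes "\<forall>j\<in>set is. i < j"
  shows "contr i (states is) = 0"
proof -
  have "(\<forall>j\<in>set is. i < j) \<longrightarrow> contr i (states is) = 0"
    by (rule list.induct[of "\<lambda>is. (\<forall>j\<in>set is. i < j) \<longrightarrow> contr i (states is) = 0"])
      (auto simp: cre_def contr_lwedge eps_def lwedge_0 contr_vac)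
  then show ?thesis
    using assms by simp
qed

text \<open>Roots of index larger than \<open>i\<close> do not involve coordinate \<open>i\<close>,
  so evaluating the first slot at \<open>i\<close> sees only the first factor. This certifies that
  increasing wedges are nonzero.\<close>

lemma states_diagonal: "sorted_wrt (<) is \<Longrightarrow> states is is = 1"
proof (induction "is")
  case Nil
  show ?case
    by (simp add: vac_def)
next
  case (Cons i "is")
  then have "contr i (states is) = 0"
    by (intro contr_states) simp
  then have "cre i (states is) (i # is) = states is is"
    unfolding cre_def lwedge_Cons by (simp add: lwedge_0 eps_def)
  then show ?case
    using Cons by simp
qed

text \<open>Since \<open>ann 0\<close> vanishes, \<open>eop 1\<close> replaces the factor of index 2
  by the one of index 1, up to sign; the result is again an increasing wedge.\<close>

lemma eop_1_states_nonzero: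
  assumes "1 \<le> k"
  shows "eop 1 (states [2..<k + 2]) \<noteq> 0"
proof
  assume zero: "eop 1 (states [2..<k + 2]) = 0"
  define l where "l = [3..<k + 2]"
  have upt: "[2..<k + 2] = 2 # l"
    using assms by (simp add: l_def upt_conv_Cons del: upt_Suc)
  have l: "0 \<notin> set l" "2 \<notin> set l" "sorted_wrt (<) (1 # l)"
    by (auto simp: l_def sorted_wrt_upt simp del: upt_Suc)
  have "ann 2 (states (2 # l)) = states l"
    using l by (simp add: ann_cre_same ann_states cre_0)
  then have "eop 1 (states [2..<k + 2]) = - states (1 # l)"
    unfolding upt eop_def one_add_one by (simp add: ann_index_0 cre_uminus)
  then have "states (1 # l) = 0"
    using zero by simp
  with states_diagonal[OF l(3)] show False
    by (simp only: zero_fun_apply zero_neq_one)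
qed

section \<open>The representation\<close>

definition gen_op :: "complex \<Rightarrow> gen \<Rightarrow> (nat list \<Rightarrow> complex) \<Rightarrow> nat list \<Rightarrow> complex" where
  "gen_op \<alpha> g = (case g of Gs i \<Rightarrow> sop i | Ge i \<Rightarrow> eop i | Gy j \<Rightarrow> yop \<alpha> j)"

lemma cre_ann_ext_power:
  assumes "f \<in> ext_power k (std_rep n)" "i \<in> {1..<n}"
  shows "cre i (ann j f) \<in> ext_power k (std_rep n)"
  unfolding cre_def ann_def lwedge_sum using assms
  by (intro cfun.subspace_sum subspace_ext_power lwedge_contr_ext_power eps_diff_std_rep) auto

lemma sop_ext_power: "f \<in> ext_power k (std_rep n) \<Longrightarrow> i \<in> {1..<n} \<Longrightarrow> sop i f \<in> ext_power k (std_rep n)"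
  and eop_ext_power: "f \<in> ext_power k (std_rep n) \<Longrightarrow> i \<in> {1..<n} \<Longrightarrow> eop i f \<in> ext_power k (std_rep n)"
  unfolding sop_def eop_def cre_diff cre_add
  by (intro cfun.subspace_diff cfun.subspace_add subspace_ext_power cre_ann_ext_power; assumption)+

lemma yop_ext_power:
  assumes "f \<in> ext_power k (std_rep n)" "j \<in> {1..n}"
  shows "yop \<alpha> j f \<in> ext_power k (std_rep n)"
proof -
  have "num_below j f \<in> ext_power k (std_rep n)"
    unfolding num_below_def using assms
    by (intro cfun.subspace_sum subspace_ext_power cre_ann_ext_power) auto
  then show ?thesis
    unfolding yop_def using assms(1)
    by (intro cfun.subspace_diff cfun.subspace_add cfun.subspace_scale subspace_ext_power)
qed

lemma sop_perm_tensor: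
  "f \<in> ext_power k V \<Longrightarrow> 0 < i \<Longrightarrow> sop i f = perm_tensor (Transposition.transpose i (i + 1)) f"
  by (simp add: perm_tensor_transpose sop_eq_reflect)

lemma sop_add: "sop i (f + g) = sop i f + sop i g"
  and sop_scale: "sop i (cscale c f) = cscale c (sop i f)"
  and eop_add: "eop i (f + g) = eop i f + eop i g"
  and eop_scale: "eop i (cscale c f) = cscale c (eop i f)"
  by (simp_all only: sop_def eop_def ann_add ann_scale cre_add cre_diff cre_scale)
    (simp_all add: fun_eq_iff cscale_apply algebra_simps)

lemma gen_op_lin:
  assumes "g \<in> V_gens n"
  shows "lin_op_on (ext_power k (std_rep n)) (gen_op \<alpha> g)"
  using assms
  by (auto simp: V_gens_def gen_op_def lin_op_on_def sop_ext_power eop_ext_power yop_ext_power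
      sop_add sop_scale eop_add eop_scale yop_add yop_scale)

lemma V_rel_evalp:
  assumes "V_rel n p q" and w: "w \<in> ext_power k (std_rep n)"
  shows "evalp (gen_op \<alpha>) p w = evalp (gen_op \<alpha>) q w"
proof -
  have mult: "evalp (gen_op \<alpha>) (p * q) v = evalp (gen_op \<alpha>) p (evalp (gen_op \<alpha>) q v)"
    if "p \<in> carrier (free_algebra (V_gens n))" "q \<in> carrier (free_algebra (V_gens n))"
      "v \<in> ext_power k (std_rep n)" for p q v
    by (intro evalp_mult[OF subspace_ext_power[of k "std_rep n"], where G = "V_gens n"] gen_op_lin that)
  have gen: "evalp (gen_op \<alpha>) (free_gen g) v = gen_op \<alpha> g v" for g v
    by (simp add: free_gen_def evalp_single wop_def)
  have one: "evalp (gen_op \<alpha>) 1 v = v" for v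
    unfolding single_one[symmetric] evalp_single by (simp add: wop_def zero_fword_def)
  have alt: "w \<in> alternating"
    using w by (rule ext_power_alternating)
  have closed: "Gs i \<in> V_gens n \<longleftrightarrow> i \<in> {1..<n}" "Ge i \<in> V_gens n \<longleftrightarrow> i \<in> {1..<n}"
    "Gy i \<in> V_gens n \<longleftrightarrow> i \<in> {1..n}" for i
    by (auto simp: V_gens_def)
  note ops = gen_op_def sop_ext_power eop_ext_power yop_ext_power w
  note rules = mult gen one evalp_uminus evalp_diff evalp_0 free_algebra_closed closed ops
  show ?thesis
    using assms(1)
  proof cases
    case (ss i)
    then show ?thesis using alt by (simp add: rules sop_sop)
  next
    case (s_s_far i j)
    then show ?thesis using far_comm(1)[OF alt, of i j] by (simp add: rules)
  next
    case (s_e_far i j)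
    then show ?thesis using far_comm(2)[OF alt, of i j] by (simp add: rules)
  next
    case (e_e_far i j)
    then show ?thesis using far_comm(3)[OF alt, of i j] by (simp add: rules)
  next
    case (braid i)
    then show ?thesis using sop_braid[OF alt, of i] by (simp add: rules)
  next
    case (y_y i j)
    then show ?thesis using yop_comm[OF alt, of \<alpha> i j] by (simp add: rules)
  next
    case (e_y_far i j)
    then show ?thesis using yop_far(1)[OF alt, of i j \<alpha>] by (simp add: rules)
  next
    case (s_y_far i j)
    then show ?thesis using yop_far(2)[OF alt, of i j \<alpha>] by (simp add: rules)
  next
    case (eee_up i)
    then show ?thesis using eop_eee_up[OF alt, of i] by (simp add: rules)
  next
    case (eee_down i)
    then show ?thesis using eop_eee_down[OF alt, of i] by (simp add: rules)
  next
    case (es i)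
    then show ?thesis using eop_sop[OF alt, of i] by (simp add: rules)
  next
    case (se i)
    then show ?thesis using sop_eop[OF alt, of i] by (simp add: rules)
  next
    case (see_down i)
    then show ?thesis using rel_see_down[OF alt, of i] by (simp add: rules)
  next
    case (see_up i)
    then show ?thesis using rel_see_up[OF alt, of i] by (simp add: rules)
  next
    case (ees_up i)
    then show ?thesis using rel_ees_up[OF alt, of i] by (simp add: rules)
  next
    case (ees_down i)
    then show ?thesis using rel_ees_down[OF alt, of i] by (simp add: rules)
  next
    case (ee i)
    then show ?thesis using eop_eop[OF alt, of i] by (simp add: rules)
  next
    case (s_y i)
    then show ?thesis using yop_rels(1)[OF alt, of i \<alpha>] by (simp add: rules)
  next
    case (y_s i)
    then show ?thesis using yop_rels(2)[OF alt, of i \<alpha>] by (simp add: rules)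
  next
    case (e_y i)
    then show ?thesis
      using yop_rels(3)[OF alt, of i \<alpha>] cfun.subspace_diff[OF subspace_ext_power] by (simp add: rules)
  next
    case (y_e i)
    then show ?thesis using yop_rels(4)[OF alt, of i \<alpha>] by (simp add: rules)
  qed
qed

section \<open>Closure properties of the two algebras\<close>

lemma V_gen_carrier: "g \<in> V_gens n \<Longrightarrow> V_gen n g \<in> carrier (V_alg n)"
  using free_algebra_closed(3)[of g "V_gens n"]
  by (auto simp: V_gen_def V_alg_def presented_algebra_def quotient_algebra_def ring.defs FactRing_def A_RCOSETS_def')

lemma ideal_V_rel: "ideal (rel_ideal (V_gens n) (V_rel n)) (free_algebra (V_gens n))"
  unfolding rel_ideal_def
proof (rule ring.genideal_ideal[OF ring_free_algebra])
  show "{p - q |p q. V_rel n p q} \<subseteq> carrier (free_algebra (V_gens n))"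
  proof (intro subsetI, elim CollectE exE conjE)
    fix r p q assume "r = p - q" "V_rel n p q"
    then show "r \<in> carrier (free_algebra (V_gens n))"
      using V_rel_carrier[of n p q] by (simp add: free_algebra_closed(6))
  qed
qed

lemma V_alg_fields:
  "carrier (V_alg n) = carrier (free_algebra (V_gens n) Quot rel_ideal (V_gens n) (V_rel n))"
  "monoid.mult (V_alg n) = monoid.mult (free_algebra (V_gens n) Quot rel_ideal (V_gens n) (V_rel n))"
  "one (V_alg n) = one (free_algebra (V_gens n) Quot rel_ideal (V_gens n) (V_rel n))"
  "add (V_alg n) = add (free_algebra (V_gens n) Quot rel_ideal (V_gens n) (V_rel n))"
  "zero (V_alg n) = zero (free_algebra (V_gens n) Quot rel_ideal (V_gens n) (V_rel n))"
  by (simp_all add: V_alg_def presented_algebra_def quotient_algebra_def ring.defs)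

lemma V_alg_closed:
  "\<one>\<^bsub>V_alg n\<^esub> \<in> carrier (V_alg n)" "\<zero>\<^bsub>V_alg n\<^esub> \<in> carrier (V_alg n)"
  "a \<in> carrier (V_alg n) \<Longrightarrow> b \<in> carrier (V_alg n) \<Longrightarrow> a \<oplus>\<^bsub>V_alg n\<^esub> b \<in> carrier (V_alg n)"
  "a \<in> carrier (V_alg n) \<Longrightarrow> b \<in> carrier (V_alg n) \<Longrightarrow> a \<otimes>\<^bsub>V_alg n\<^esub> b \<in> carrier (V_alg n)"
  "\<zero>\<^bsub>V_alg n\<^esub> \<oplus>\<^bsub>V_alg n\<^esub> \<zero>\<^bsub>V_alg n\<^esub> = \<zero>\<^bsub>V_alg n\<^esub>"
proof -
  interpret Q: ring "free_algebra (V_gens n) Quot rel_ideal (V_gens n) (V_rel n)"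
    by (rule ideal.quotient_is_ring[OF ideal_V_rel])
  show "\<one>\<^bsub>V_alg n\<^esub> \<in> carrier (V_alg n)" "\<zero>\<^bsub>V_alg n\<^esub> \<in> carrier (V_alg n)"
    "a \<in> carrier (V_alg n) \<Longrightarrow> b \<in> carrier (V_alg n) \<Longrightarrow> a \<oplus>\<^bsub>V_alg n\<^esub> b \<in> carrier (V_alg n)"
    "a \<in> carrier (V_alg n) \<Longrightarrow> b \<in> carrier (V_alg n) \<Longrightarrow> a \<otimes>\<^bsub>V_alg n\<^esub> b \<in> carrier (V_alg n)"
    "\<zero>\<^bsub>V_alg n\<^esub> \<oplus>\<^bsub>V_alg n\<^esub> \<zero>\<^bsub>V_alg n\<^esub> = \<zero>\<^bsub>V_alg n\<^esub>"
    unfolding V_alg_fields by simp_all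
qed

lemma V_alg_smult_closed:
  assumes "a \<in> carrier (V_alg n)"
  shows "c \<odot>\<^bsub>V_alg n\<^esub> a \<in> carrier (V_alg n)"
proof -
  let ?F = "free_algebra (V_gens n)" and ?I = "rel_ideal (V_gens n) (V_rel n)"
  obtain p where p: "p \<in> carrier ?F" "a = ?I +>\<^bsub>?F\<^esub> p"
    using assms unfolding V_alg_fields by (auto simp: FactRing_def A_RCOSETS_def')
  have "Poly_Mapping.single 0 c \<in> carrier ?F"
    by (auto simp: free_algebra_def zero_fword_def)
  then have "Poly_Mapping.single 0 c * p \<in> carrier ?F"
    using p(1) by (rule free_algebra_closed(7))
  moreover have "c \<odot>\<^bsub>V_alg n\<^esub> a = ?I +>\<^bsub>?F\<^esub> (Poly_Mapping.single 0 c * p)"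
    unfolding p(2) V_alg_def presented_algebra_def by (rule smult_quotient[OF ideal_V_rel p(1)])
  ultimately show ?thesis
    unfolding V_alg_fields by (auto simp: FactRing_def A_RCOSETS_def')
qed

lemma A_alg_fields:
  "monoid.mult (A_alg n) = monoid.mult (V_alg n)" "one (A_alg n) = one (V_alg n)"
  "add (A_alg n) = add (V_alg n)" "zero (A_alg n) = zero (V_alg n)"
  "c \<odot>\<^bsub>A_alg n\<^esub> a = c \<odot>\<^bsub>V_alg n\<^esub> a"
  by (simp_all add: A_alg_def)

lemma A_alg_carrier_subset: "carrier (A_alg n) \<subseteq> carrier (V_alg n)"
proof
  fix a assume "a \<in> carrier (A_alg n)"
  then have "a \<in> gen_subalgebra (V_alg n) (V_gen n ` (Gs ` {1..<n} \<union> Ge ` {1..<n}))"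
    by (simp add: A_alg_def)
  then show "a \<in> carrier (V_alg n)"
  proof (induction rule: gen_subalgebra.induct)
    case (incl h)
    then obtain g where "g \<in> Gs ` {1..<n} \<union> Ge ` {1..<n}" "h = V_gen n g"
      by blast
    then show ?case
      by (auto intro!: V_gen_carrier simp: V_gens_def)
  qed (simp_all add: V_alg_closed V_alg_smult_closed)
qed

lemma algebra_rep_A_alg: "algebra_rep (V_alg n) W \<rho> \<Longrightarrow> algebra_rep (A_alg n) W \<rho>"
  using A_alg_carrier_subset[of n] unfolding algebra_rep_def A_alg_fields by (meson subsetD)

lemma JM_carrier: "j \<le> n \<Longrightarrow> JM n j \<in> carrier (V_alg n)"
  by (induction n j rule: JM.induct)
    (auto simp: A_alg_fields V_gens_def intro!: V_alg_closed V_gen_carrier)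

theorem theorem38:
  fixes n k :: nat and \<alpha> :: complex
  defines "W \<equiv> ext_power k (std_rep n)"
  assumes "n \<ge> 3" and "1 \<le> k" and "k \<le> n - 2"
  shows "irreducible_under (perm_tensor ` {p. p permutes {1..n}}) W \<and>
    (\<exists>\<rho>. irreducible_rep (V_alg n) W \<rho> \<and>
         calibrated_V_rep n W \<rho> \<and>
         (\<forall>i\<in>{1..<n}. \<forall>w\<in>W. \<rho> (V_gen n (Gs i)) w = perm_tensor (Transposition.transpose i (i + 1)) w) \<and>
         (\<forall>i\<in>{1..<n}. \<exists>w\<in>W. \<rho> (V_gen n (Ge i)) w \<noteq> 0) \<and>
         (\<forall>w\<in>W. \<rho> (V_gen n (Gy 1)) w = cscale \<alpha> w) \<and>
         (\<alpha> = 0 \<longrightarrow>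
            irreducible_rep (A_alg n) W \<rho> \<and>
            calibrated_A_rep n W \<rho> \<and>
            (\<forall>j\<in>{1..n}. \<forall>w\<in>W. \<rho> (V_gen n (Gy j)) w = \<rho> (JM n j) w)))"
proof -
  have W: "cfun.subspace W"
    unfolding W_def by (rule subspace_ext_power)
  have W_alt: "w \<in> alternating" if "w \<in> W" for w
    using that unfolding W_def by (rule ext_power_alternating)
  \<comment> \<open>The relation \<open>e_i e_{i+1} e_i = - e_i\<close> passes nonvanishing from
    \<open>e_i\<close> to \<open>e_{i+1}\<close>, starting with \<open>e_1\<close>.\<close>
  have eop_nonzero: "\<exists>w\<in>W. eop i w \<noteq> 0" if "i \<in> {1..<n}" for i
  proof -
    have "1 \<le> i" "i < n"
      using that by auto
    then show ?thesis
    proof (induction i rule: nat_induct_at_least)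
      case base
      \<comment> \<open>The largest index is \<open>k + 1\<close>, which is at most
        \<open>n - 1\<close> exactly because \<open>k \<le> n - 2\<close>.\<close>
      have "states [2..<k + 2] \<in> W"
        unfolding W_def using assms(3,4) by (intro states_in_ext_power) auto
      then show ?case
        using eop_1_states_nonzero[OF assms(3)] by blast
    next
      case (Suc i)
      then obtain w where w: "w \<in> W" "eop i w \<noteq> 0"
        using Suc_lessD by blast
      have "eop i (eop (i + 1) (eop i w)) = - eop i w"
        using Suc by (intro eop_eee_down W_alt w) simp
      moreover have "eop i 0 = 0"
        using eop_scale[of i 0 0] by simp
      ultimately have "eop (Suc i) (eop i w) \<noteq> 0"
        using w(2) by (metis Suc_eq_plus1 neg_equal_0_iff_equal)
      moreover have "eop i w \<in> W"
        using w(1) Suc unfolding W_def by (intro eop_ext_power) auto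
      ultimately show ?case
        by blast
    qed
  qed
  have "\<exists>w\<in>W. eop 1 w \<noteq> 0"
    using eop_nonzero[of 1] assms(2) by simp
  moreover have "eop 1 0 = 0"
    using eop_scale[of 1 0 0] by simp
  ultimately have W_nonzero: "W \<noteq> {0}"
    by auto
  \<comment> \<open>Stated for any family whose stable subspaces admit the simple transpositions, so
    that it serves the symmetric group and both algebras.\<close>
  have irred: "irreducible_under F W"
    if F: "\<And>U i f. cfun.subspace U \<Longrightarrow> U \<subseteq> W \<Longrightarrow> \<forall>f\<in>F. f ` U \<subseteq> U \<Longrightarrow> i \<in> {1..<n} \<Longrightarrow> f \<in> U \<Longrightarrow>
      perm_tensor (Transposition.transpose i (i + 1)) f \<in> U" for F
    unfolding irreducible_under_def
  proof (intro conjI allI impI W_nonzero)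
    fix U assume U: "cfun.subspace U" "U \<subseteq> W" "\<forall>f\<in>F. f ` U \<subseteq> U"
    note step = F[OF U]
    have "perm_tensor (Transposition.transpose 1 x) f \<in> U" if "2 \<le> x" "x \<le> n" "f \<in> U" for x f
      using that
    proof (induction x arbitrary: f rule: nat_induct_at_least)
      case base
      then show ?case
        using step[of 1 f] by (simp add: numeral_2_eq_2)
    next
      case (Suc x)
      let ?t = "Transposition.transpose x (x + 1)"
      \<comment> \<open>Conjugating \<open>(1 x)\<close> by a simple transposition yields the next
        transposition through 1.\<close>
      have "Transposition.transpose 1 (Suc x) = ?t \<circ> Transposition.transpose 1 x \<circ> ?t"
        using Suc.hyps by (auto simp: fun_eq_iff Transposition.transpose_def)
      then have "perm_tensor (Transposition.transpose 1 (Suc x)) f =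
          perm_tensor ?t (perm_tensor (Transposition.transpose 1 x) (perm_tensor ?t f))"
        by (simp add: perm_tensor_comp bij_comp)
      moreover have "perm_tensor ?t f \<in> U"
        using Suc by (intro step) auto
      then have "perm_tensor (Transposition.transpose 1 x) (perm_tensor ?t f) \<in> U"
        using Suc.prems by (intro Suc.IH) auto
      then have "perm_tensor ?t (perm_tensor (Transposition.transpose 1 x) (perm_tensor ?t f)) \<in> U"
        using Suc by (intro step) auto
      ultimately show ?case
        by simp
    qed
    then show "U = {0} \<or> U = W"
      using ext_power_std_rep_irreducible[OF U(1), of k n] U(2) unfolding W_def by auto
  qed
  have "irreducible_under (perm_tensor ` {p. p permutes {1..n}}) W"
  proof (rule irred)
    fix U i f
    assume "\<forall>f\<in>perm_tensor ` {p. p permutes {1..n}}. f ` U \<subseteq> U" "i \<in> {1..<n}" "f \<in> U"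
    moreover have "Transposition.transpose i (i + 1) permutes {1..n}"
      using \<open>i \<in> {1..<n}\<close> by (intro permutes_swap_id) auto
    ultimately show "perm_tensor (Transposition.transpose i (i + 1)) f \<in> U"
      by blast
  qed
  obtain \<rho> where rep: "algebra_rep (V_alg n) W \<rho>"
    and \<rho>: "\<forall>p\<in>carrier (free_algebra (V_gens n)). \<forall>w\<in>W.
      \<rho> (rel_ideal (V_gens n) (V_rel n) +>\<^bsub>free_algebra (V_gens n)\<^esub> p) w = evalp (gen_op \<alpha>) p w"
    using presented_algebra_rep[OF W, where G = "V_gens n" and f = "gen_op \<alpha>" and R = "V_rel n"]
      gen_op_lin[of _ n k \<alpha>] V_rel_carrier V_rel_evalp[of n _ _ _ k \<alpha>]
    unfolding V_alg_def W_def by blast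
  have gen: "\<rho> (V_gen n g) w = gen_op \<alpha> g w" if "g \<in> V_gens n" "w \<in> W" for g w
    using \<rho> free_algebra_closed(3)[OF that(1)] that(2)
    by (simp add: V_gen_def) (simp add: free_gen_def evalp_single wop_def)
  have gens: "Gs i \<in> V_gens n \<longleftrightarrow> i \<in> {1..<n}" "Ge i \<in> V_gens n \<longleftrightarrow> i \<in> {1..<n}"
    "Gy i \<in> V_gens n \<longleftrightarrow> i \<in> {1..n}" for i
    by (auto simp: V_gens_def)
  have gen_s: "\<rho> (V_gen n (Gs i)) w = sop i w" and gen_e: "\<rho> (V_gen n (Ge i)) w = eop i w"
    if "i \<in> {1..<n}" "w \<in> W" for i w
    using gen[of "Gs i" w] gen[of "Ge i" w] that by (simp_all add: gens gen_op_def)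
  have gen_y: "\<rho> (V_gen n (Gy j)) w = yop \<alpha> j w" if "j \<in> {1..n}" "w \<in> W" for j w
    using gen[of "Gy j" w] that by (simp add: gens gen_op_def)
  have s: "\<rho> (V_gen n (Gs i)) w = perm_tensor (Transposition.transpose i (i + 1)) w"
    if "i \<in> {1..<n}" "w \<in> W" for i w
    using gen_s[OF that] sop_perm_tensor[of w k "std_rep n" i] that unfolding W_def by simp
  have irred_alg: "irreducible_under (\<rho> ` C) W" if C: "V_gen n ` Gs ` {1..<n} \<subseteq> C" for C
  proof (rule irred)
    fix U i f
    assume U: "U \<subseteq> W" "\<forall>f\<in>\<rho> ` C. f ` U \<subseteq> U" "i \<in> {1..<n}" "f \<in> U"
    have "V_gen n (Gs i) \<in> C"
      using C U(3) by blast
    then have "\<rho> (V_gen n (Gs i)) f \<in> U"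
      using U(2,4) by blast
    then show "perm_tensor (Transposition.transpose i (i + 1)) f \<in> U"
      using s[OF U(3) subsetD[OF U(1,4)]] by simp
  qed
  have diag: "simultaneously_diagonal (A ` {1..n}) W"
    if A: "\<And>j w. j \<in> {1..n} \<Longrightarrow> w \<in> W \<Longrightarrow> A j w = yop \<alpha> j w" for A
  proof (rule simultaneously_diagonalI)
    show "cfun.span {states is |is. length is = k \<and> set is \<subseteq> {1..<n}} = W"
      unfolding W_def by (rule ext_power_span_states)
    fix f b assume f: "f \<in> A ` {1..n}" and b: "b \<in> {states is |is. length is = k \<and> set is \<subseteq> {1..<n}}"
    from f obtain j where j: "f = A j" "j \<in> {1..n}" ..
    from b obtain l where l: "b = states l" "length l = k" "set l \<subseteq> {1..<n}"
      by auto
    have "b \<in> W"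
      unfolding W_def l(1) using l(2,3) by (rule states_in_ext_power)
    then show "\<exists>c. f b = cscale c b"
      using A[OF j(2)] yop_states[OF l(3), of \<alpha> j] unfolding j(1) l(1) by simp
  qed
  have "\<rho> (JM n j) w = yop \<alpha> j w" if "\<alpha> = 0" "j \<in> {1..n}" "w \<in> W" for j w
  proof -
    note hom = rep[unfolded algebra_rep_def]
    have add: "\<rho> (a \<oplus>\<^bsub>V_alg n\<^esub> b) w = \<rho> a w + \<rho> b w" and mult: "\<rho> (a \<otimes>\<^bsub>V_alg n\<^esub> b) w = \<rho> a (\<rho> b w)"
      if "a \<in> carrier (V_alg n)" "b \<in> carrier (V_alg n)" "w \<in> W" for a b w
      using hom that by blast+
    have "1 \<le> j" "j \<le> n"
      using that by auto
    then show ?thesis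
      using \<open>w \<in> W\<close>
    proof (induction j arbitrary: w rule: nat_induct_at_least)
      case base
      \<comment> \<open>That zero acts as zero follows from additivity by cancellation.\<close>
      have "\<rho> \<zero>\<^bsub>V_alg n\<^esub> w = \<rho> \<zero>\<^bsub>V_alg n\<^esub> w + \<rho> \<zero>\<^bsub>V_alg n\<^esub> w"
        using add[OF V_alg_closed(2) V_alg_closed(2) base(2)] by (simp only: V_alg_closed(5))
      then have "\<rho> \<zero>\<^bsub>V_alg n\<^esub> w = 0"
        by simp
      then show ?case
        using \<open>\<alpha> = 0\<close> by (simp add: A_alg_fields yop_def num_below_def)
    next
      case (Suc j)
      let ?s = "V_gen n (Gs j)" and ?e = "V_gen n (Ge j)"
      have j: "j \<in> {1..<n}"
        using Suc by auto
      then obtain m where m: "j = Suc m"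
        by (cases j) auto
      have carr: "?s \<in> carrier (V_alg n)" "?e \<in> carrier (V_alg n)" "JM n j \<in> carrier (V_alg n)"
        using j by (auto intro!: V_gen_carrier JM_carrier simp: gens)
      have sw: "sop j w \<in> W" and ysw: "yop \<alpha> j (sop j w) \<in> W"
        using Suc.prems j unfolding W_def by (auto intro!: sop_ext_power yop_ext_power)
      have "JM n (Suc j) = ?s \<otimes>\<^bsub>V_alg n\<^esub> JM n j \<otimes>\<^bsub>V_alg n\<^esub> ?s \<oplus>\<^bsub>V_alg n\<^esub> ?s \<oplus>\<^bsub>V_alg n\<^esub> ?e"
        by (simp add: m A_alg_fields)
      then have "\<rho> (JM n (Suc j)) w = sop j (yop \<alpha> j (sop j w)) + sop j w + eop j w"
        using Suc.IH[OF _ sw] Suc.prems j carr sw ysw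
        by (simp add: add mult V_alg_closed gen_s gen_e)
      \<comment> \<open>Apply the relation for \<open>s_j y_j - y_{j+1} s_j\<close> to
        \<open>sop j w\<close>, then use \<open>s_j s_j = 1\<close> and
        \<open>e_j s_j = e_j\<close>: this is the recursion of the Jucys-Murphy elements.\<close>
      also have "\<dots> = yop \<alpha> (Suc j) w"
        using yop_rels(1)[OF W_alt[OF sw], of j \<alpha>] sop_sop[OF W_alt[OF Suc.prems(2)], of j]
          eop_sop[OF W_alt[OF Suc.prems(2)], of j] j
        by (simp add: algebra_simps)
      finally show ?case .
    qed
  qed
  then have JM: "\<rho> (JM n j) w = yop \<alpha> j w" if "\<alpha> = 0" "j \<in> {1..n}" "w \<in> W" for j w
    using that by blast
  have "irreducible_rep (V_alg n) W \<rho>"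
    unfolding irreducible_rep_def using rep by (intro conjI irred_alg) (auto intro!: V_gen_carrier simp: gens)
  moreover have "calibrated_V_rep n W \<rho>"
    unfolding calibrated_V_rep_def using rep by (intro conjI diag gen_y)
  moreover have "\<rho> (V_gen n (Gy 1)) w = cscale \<alpha> w" if "w \<in> W" for w
    using gen_y[of 1 w] that assms(2) by (simp add: yop_def num_below_def)
  moreover have "irreducible_rep (A_alg n) W \<rho>"
    unfolding irreducible_rep_def using algebra_rep_A_alg[OF rep]
    by (intro conjI irred_alg) (auto simp: A_alg_def intro!: gen_subalgebra.incl)
  moreover have "calibrated_A_rep n W \<rho>" if "\<alpha> = 0"
    unfolding calibrated_A_rep_def using algebra_rep_A_alg[OF rep] that by (intro conjI diag JM)
  ultimately show ?thesis
    using \<open>irreducible_under (perm_tensor ` {p. p permutes {1..n}}) W\<close> s eop_nonzero gen_e gen_y JM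
    by (intro conjI exI[of _ \<rho>]) auto
qed

end
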